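(* For every reduced spherical convex body $R\subset S^2$ with $\Delta(R)<\frac{\pi}{2}$ we have $\mathrm{diam}(R)\leq\arccos(\cos^2\Delta(R))$. This value is attained if and only if $R$ is the quarter of a disk of radius $\Delta(R)$. If $R\subset S^2$ is a reduced spherical convex body with $\Delta(R)\geq\frac{\pi}{2}$, then $\mathrm{diam}(R)=\Delta(R)$.
   Context: $S^2$ is the unit sphere in $E^3$ with spherical (geodesic) distance. $\mathrm{diam}$ is the diameter with respect to it. For non-antipodal $a,b$, the arc $ab$ is the shorter part of the great circle through $a,b$. A set $C\subset S^2$ is convex if it contains no pair of antipodes and $ab\subset C$ for all $a,b\in C$. A convex body is a closed convex set with non-empty interior. A disk of radius $\rho$ is the set of points at distance at most $\rho$ from a point (its center). A quarter of a disk is any of the four parts into which the disk is dissected by two orthogonal great circles through its center. A hemisphere is a disk of radius $\frac{\pi}{2}$. A hemisphere $K$ supports $C$ if $C\subset K$ and $\mathrm{bd}(C)\cap\mathrm{bd}(K)\neq\emptyset$. If hemispheres $G,H$ are different and not opposite (centers not antipodal), $L=G\cap H$ is a lune, bounded by the semicircles $\mathrm{bd}(G)\cap H$ and $\mathrm{bd}(H)\cap G$. Its thickness $\Delta(L)$ is the spherical distance between the centers (midpoints) of these semicircles. For a hemisphere $K$ supporting $C$, $\mathrm{width}_K(C)$ is the minimum of $\Delta(K\cap K')$ over all hemispheres $K'$ supporting $C$ for which $K\cap K'$ is a lune. The thickness $\Delta(C)$ is the minimum of $\mathrm{width}_K(C)$ over all hemispheres $K$ supporting $C$. A convex body $R$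 is reduced if $\Delta(Z)<\Delta(R)$ for every convex body $Z\subset R$ with $Z\neq R$. *)

theory Defs
  imports "HOL-Analysis.Analysis"
begin

abbreviation S2 :: "(real^3) set" where
  "S2 \<equiv> sphere 0 1"

definition sph_dist :: "real^3 \<Rightarrow> real^3 \<Rightarrow> real" where
  "sph_dist a b = arccos (a \<bullet> b)"

definition sph_diam :: "(real^3) set \<Rightarrow> real" where
  "sph_diam C = (SUP (a, b) \<in> C \<times> C. sph_dist a b)"

definition sph_interior :: "(real^3) set \<Rightarrow> (real^3) set" where
  "sph_interior C = top_of_set S2 interior_of C"

definition bd :: "(real^3) set \<Rightarrow> (real^3) set" where
  "bd C = top_of_set S2 frontier_of C"

text \<open>For non-antipodal \<open>a\<close>, \<open>b\<close> on the sphere, the great circle through them is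
  \<open>S2 \<inter> span {a, b}\<close>, and its shorter part is the central projection of the chord from \<open>a\<close>
  to \<open>b\<close>, that is, the part spanned by non-negative coefficients (a single point if \<open>a = b\<close>).\<close>
definition sph_arc :: "real^3 \<Rightarrow> real^3 \<Rightarrow> (real^3) set" where
  "sph_arc a b = {x \<in> S2. \<exists>s t. 0 \<le> s \<and> 0 \<le> t \<and> x = s *\<^sub>R a + t *\<^sub>R b}"

definition sph_convex :: "(real^3) set \<Rightarrow> bool" where
  "sph_convex C \<longleftrightarrow>
     C \<subseteq> S2 \<and> (\<forall>a\<in>C. - a \<notin> C) \<and> (\<forall>a\<in>C. \<forall>b\<in>C. sph_arc a b \<subseteq> C)"

definition sph_convex_body :: "(real^3) set \<Rightarrow> bool" where
  "sph_convex_body C \<longleftrightarrow>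
     sph_convex C \<and> closedin (top_of_set S2) C \<and> sph_interior C \<noteq> {}"

definition disk :: "real^3 \<Rightarrow> real \<Rightarrow> (real^3) set" where
  "disk c \<rho> = {x \<in> S2. sph_dist c x \<le> \<rho>}"

text \<open>A hemisphere is determined by its center, so below hemispheres are given by their centers.\<close>
definition hemisphere :: "real^3 \<Rightarrow> (real^3) set" where
  "hemisphere c = disk c (pi / 2)"

text \<open>Two orthogonal great circles through \<open>c\<close> are the boundaries of hemispheres with centers
  \<open>u\<close>, \<open>v\<close> such that \<open>c\<close>, \<open>u\<close>, \<open>v\<close> are pairwise orthogonal. The four parts of the disk arise
  from the choices of sign in \<open>\<plusminus>u\<close>, \<open>\<plusminus>v\<close>.\<close>
definition is_disk_quarter :: "(real^3) set \<Rightarrow> real \<Rightarrow> bool" where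
  "is_disk_quarter Q \<rho> \<longleftrightarrow>
     (\<exists>c\<in>S2. \<exists>u\<in>S2. \<exists>v\<in>S2. orthogonal c u \<and> orthogonal c v \<and> orthogonal u v \<and>
        Q = disk c \<rho> \<inter> hemisphere u \<inter> hemisphere v)"

definition supports :: "real^3 \<Rightarrow> (real^3) set \<Rightarrow> bool" where
  "supports k C \<longleftrightarrow> k \<in> S2 \<and> C \<subseteq> hemisphere k \<and> bd C \<inter> bd (hemisphere k) \<noteq> {}"

text \<open>The hemispheres with centers \<open>g\<close>, \<open>h\<close> are different and not opposite.\<close>
definition forms_lune :: "real^3 \<Rightarrow> real^3 \<Rightarrow> bool" where
  "forms_lune g h \<longleftrightarrow> g \<in> S2 \<and> h \<in> S2 \<and> g \<noteq> h \<and> g \<noteq> - h"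

text \<open>The end-points of a semicircle are its only pair of antipodes; the center is the point of
  the semicircle equidistant from them.\<close>
definition semicircle_center :: "(real^3) set \<Rightarrow> real^3" where
  "semicircle_center S =
     (THE c. c \<in> S \<and> (\<forall>p. p \<in> S \<and> - p \<in> S \<longrightarrow> sph_dist c p = sph_dist c (- p)))"

definition lune_thickness :: "real^3 \<Rightarrow> real^3 \<Rightarrow> real" where
  "lune_thickness g h =
     sph_dist (semicircle_center (bd (hemisphere g) \<inter> hemisphere h))
              (semicircle_center (bd (hemisphere h) \<inter> hemisphere g))"

text \<open>For a convex body the infima in the next two definitions are over non-empty sets and are
  attained, so that they are minima.\<close>
definition width :: "real^3 \<Rightarrow> (real^3) set \<Rightarrow> real" where
  "width k C = (INF k' \<in> {k'. supports k' C \<and> forms_lune k k'}. lune_thickness k k')"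

definition thickness :: "(real^3) set \<Rightarrow> real" where
  "thickness C = (INF k \<in> {k. supports k C}. width k C)"

definition sph_reduced :: "(real^3) set \<Rightarrow> bool" where
  "sph_reduced R \<longleftrightarrow> sph_convex_body R \<and>
     (\<forall>Z. sph_convex_body Z \<and> Z \<subseteq> R \<and> Z \<noteq> R \<longrightarrow> thickness Z < thickness R)"

end

theory Submission
  imports Defs
begin

text \<open>
  The proof passes to the polar \<open>D\<close> of \<open>R\<close>, the set of all \<open>k\<close> with \<open>R\<close> in the hemisphere centered
  at \<open>k\<close>. The lune of the hemispheres centered at \<open>g\<close> and \<open>h\<close> has thickness \<open>\<pi>\<close> minus the distance of
  \<open>g\<close> and \<open>h\<close> (\<open>lune_thickness_eq\<close>), so the thickness of a body is \<open>\<pi>\<close> minus the diameter of its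
  polar (\<open>thickness_attained\<close>). Write \<open>\<Delta>\<close> for the thickness of \<open>R\<close>. Then any two points of \<open>D\<close> have
  inner product at least \<open>- cos \<Delta>\<close>, this bound is attained, and, as cutting a piece off \<open>R\<close> enlarges
  \<open>D\<close>, \<open>R\<close> is reduced only if no larger polar has the same diameter.

  If \<open>\<Delta> \<ge> \<pi> / 2\<close>, the distance bound \<open>\<pi> - \<Delta>\<close> is at most \<open>\<pi> / 2\<close>, so it survives taking convex
  hulls. Hence \<open>D\<close> contains every point within \<open>\<pi> - \<Delta>\<close> of all its points (\<open>polar_complete\<close>). As for
  complete plane sets, it follows that \<open>D\<close> has constant width: from a point \<open>p\<close> of \<open>D\<close> on the boundary
  of the hemisphere centered at \<open>r \<in> R\<close>, go the distance \<open>\<pi> - \<Delta>\<close> towards \<open>r\<close>, and the point reached is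
  in \<open>D\<close> (\<open>polar_opposite_wide\<close>). That no two points of \<open>R\<close> are farther apart than \<open>\<Delta>\<close> is a short
  computation from this.

  If \<open>\<Delta> < \<pi> / 2\<close>, call \<open>e \<in> R\<close> thin if it is the center of one of the bounding semicircles of a lune
  of thickness \<open>\<Delta>\<close> that contains \<open>R\<close>. Cutting a thin slice off \<open>R\<close> along a supporting great circle
  produces a lune of thickness less than \<open>\<Delta>\<close> around the rest, and one of its centers lies on the cut.
  In the limit every supporting great circle contains a thin point
  (\<open>support_touches_thin_point\<close>), so \<open>R\<close> is the spherical hull of its thin points
  (\<open>thin_points_span\<close>). It remains to show \<open>cos\<^sup>2 \<Delta> \<le> e\<^sub>1 \<bullet> e\<^sub>2\<close> for thin points. If \<open>f\<^sub>i\<close> is the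
  opposite center of the lune of \<open>e\<^sub>i\<close>, then \<open>f\<^sub>i \<in> R\<close>, and as \<open>R\<close> lies in both lunes, each of the two
  arcs \<open>e\<^sub>i f\<^sub>i\<close> of length \<open>\<Delta>\<close> projects orthogonally into the plane sector of the other. A
  Perron-Frobenius argument shows that two such arcs meet (\<open>projecting_arcs_meet\<close>). So \<open>e\<^sub>2\<close> is at
  distance at most \<open>\<Delta>\<close> from a point of the arc \<open>e\<^sub>1 f\<^sub>1\<close>, its projection to the plane of that arc has
  norm at least \<open>cos \<Delta>\<close>, and the angle of the projection with \<open>e\<^sub>1\<close> is at most \<open>\<Delta>\<close>. The product of the
  two bounds is \<open>cos\<^sup>2 \<Delta>\<close>. Equality forces \<open>f\<^sub>1 = f\<^sub>2\<close> and orthogonal arcs, and then \<open>R\<close> contains the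
  quarter of a disk that they span. The quarter has thickness at least \<open>\<Delta>\<close> (\<open>thickness_Q_ge\<close>), so it
  is all of the reduced body \<open>R\<close>.
\<close>

section \<open>The polar of a set on the sphere\<close>

text \<open>Spherical polarity. For a set on the sphere these are the centers of the hemispheres that contain it.\<close>

definition polar :: "(real^3) set \<Rightarrow> (real^3) set" where
  "polar C = {k \<in> S2. \<forall>x\<in>C. 0 \<le> k \<bullet> x}"

lemma polarD: "k \<in> polar C \<Longrightarrow> x \<in> C \<Longrightarrow> 0 \<le> k \<bullet> x"
  and polarD': "k \<in> polar C \<Longrightarrow> x \<in> C \<Longrightarrow> 0 \<le> x \<bullet> k"
  by (auto simp: polar_def inner_commute)

lemma polar_norm: "k \<in> polar C \<Longrightarrow> norm k = 1"
  by (auto simp: polar_def)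

lemma inner_unit_self: "norm (x::real^3) = 1 \<Longrightarrow> x \<bullet> x = 1"
  by (simp add: dot_square_norm)

lemma inner_unit_bounds:
  fixes x y :: "real^3"
  assumes "norm x = 1" "norm y = 1"
  shows "- 1 \<le> x \<bullet> y" "x \<bullet> y \<le> 1"
  using Cauchy_Schwarz_ineq2[of x y] assms by auto

lemma inner_unit_eq_1:
  fixes x y :: "real^3"
  assumes "norm x = 1" "norm y = 1" "x \<bullet> y = 1"
  shows "x = y"
  using assms norm_cauchy_schwarz_eq[of x y] by auto

lemma inner_unit_eq_minus_1:
  fixes x y :: "real^3"
  assumes "norm x = 1" "norm y = 1" "x \<bullet> y = - 1"
  shows "x = - y"
  using inner_unit_eq_1[of x "- y"] assms by auto

lemma sgn_in_S2: "(x::real^3) \<noteq> 0 \<Longrightarrow> sgn x \<in> S2"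
  by (simp add: norm_sgn)

lemma inner_sgn: "sgn (x::real^3) \<bullet> y = (x \<bullet> y) / norm x"
  "y \<bullet> sgn x = (y \<bullet> x) / norm x"
  by (simp_all add: sgn_div_norm divide_inverse)

section \<open>Convex sets on the sphere and their polars\<close>

lemma sph_convexD:
  assumes "sph_convex C"
  shows "C \<subseteq> S2" "\<And>a. a \<in> C \<Longrightarrow> norm a = 1" "\<And>a. a \<in> C \<Longrightarrow> - a \<notin> C"
    "\<And>a b. a \<in> C \<Longrightarrow> b \<in> C \<Longrightarrow> sph_arc a b \<subseteq> C"
  using assms by (auto simp: sph_convex_def)

lemma conic_combination:
  assumes "sph_convex C" "a \<in> C" "b \<in> C" "0 \<le> s" "0 \<le> t" "0 < s + t"
  shows "s *\<^sub>R a + t *\<^sub>R b \<noteq> 0" "sgn (s *\<^sub>R a + t *\<^sub>R b) \<in> C"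
proof -
  note C = sph_convexD[OF assms(1)]
  show nz: "s *\<^sub>R a + t *\<^sub>R b \<noteq> 0"
  proof
    assume "s *\<^sub>R a + t *\<^sub>R b = 0"
    then have eq: "s *\<^sub>R a = - (t *\<^sub>R b)"
      by (simp add: eq_neg_iff_add_eq_0)
    then have "norm (s *\<^sub>R a) = norm (t *\<^sub>R b)"
      by simp
    then have "s = t" "t > 0"
      using assms C by auto
    with eq have "t *\<^sub>R a = t *\<^sub>R (- b)"
      by simp
    with \<open>t > 0\<close> have "a = - b"
      by (metis order_less_irrefl scaleR_cancel_left)
    then show False
      using assms C(3) by auto
  qed
  have "sgn (s *\<^sub>R a + t *\<^sub>R b) \<in> sph_arc a b"
    unfolding sph_arc_def
  proof (clarsimp simp: norm_sgn nz)
    let ?n = "norm (s *\<^sub>R a + t *\<^sub>R b)"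
    show "\<exists>s'\<ge>0. \<exists>t'\<ge>0. sgn (s *\<^sub>R a + t *\<^sub>R b) = s' *\<^sub>R a + t' *\<^sub>R b"
      by (rule exI[of _ "s / ?n"], simp add: assms, rule exI[of _ "t / ?n"])
        (simp add: assms sgn_div_norm scaleR_add_right divide_inverse_commute)
  qed
  moreover have "sph_arc a b \<subseteq> C"
    by (rule sph_convexD(4)[OF assms(1-3)])
  ultimately show "sgn (s *\<^sub>R a + t *\<^sub>R b) \<in> C"
    by blast
qed

text \<open>Every point of the convex hull in space projects centrally into \<open>C\<close>, so questions about
  spherical hulls can be settled by the linear separation theorems.\<close>

lemma hull_on_rays:
  assumes "sph_convex C" "x \<in> convex hull C"
  shows "x \<noteq> 0" "sgn x \<in> C"
proof -
  let ?K = "{x. x \<noteq> 0 \<and> sgn x \<in> C}"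
  have "convex ?K"
    unfolding convex_alt
  proof (intro ballI allI impI)
    fix a b :: "real^3" and u :: real
    assume ab: "a \<in> ?K" "b \<in> ?K" and u: "0 \<le> u \<and> u \<le> 1"
    have eq: "(1 - u) *\<^sub>R a + u *\<^sub>R b = ((1 - u) * norm a) *\<^sub>R sgn a + (u * norm b) *\<^sub>R sgn b"
    proof -
      have "(c * norm v) *\<^sub>R sgn v = c *\<^sub>R v" if "v \<noteq> 0" for c and v :: "real^3"
        using that by (simp add: sgn_div_norm)
      then show ?thesis using ab by simp
    qed
    have "0 < (1 - u) * norm a + u * norm b"
      using ab u by (smt (verit) mem_Collect_eq mult_nonneg_nonneg mult_pos_pos norm_ge_zero zero_less_norm_iff)
    then show "(1 - u) *\<^sub>R a + u *\<^sub>R b \<in> ?K"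
      unfolding eq using conic_combination[OF assms(1), of "sgn a" "sgn b"] ab u by auto
  qed
  moreover have "C \<subseteq> ?K"
    using sph_convexD[OF assms(1)] by (auto simp: sgn_div_norm)
  ultimately have "convex hull C \<subseteq> ?K"
    by (simp add: hull_minimal)
  with assms(2) show "x \<noteq> 0" "sgn x \<in> C"
    by auto
qed

text \<open>Separating the ray from the compact hull gives \<open>a \<bullet> x \<le> 0\<close> only; tilting \<open>a\<close> away from \<open>x\<close> by
  less than the gap makes both inequalities strict.\<close>

lemma separate_ray_from_hull:
  fixes E :: "(real^3) set"
  assumes "compact E" "\<And>e. e \<in> E \<Longrightarrow> norm e = 1" "norm x = 1"
    and miss: "\<And>t. 0 \<le> t \<Longrightarrow> t *\<^sub>R x \<notin> convex hull E"
  shows "\<exists>a. a \<bullet> x < 0 \<and> (\<forall>e\<in>E. 0 < a \<bullet> e)"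
proof (cases "E = {}")
  case True
  then show ?thesis
    using assms(3) by (auto intro!: exI[of _ "- x"] simp: inner_unit_self)
next
  case False
  let ?ray = "(\<lambda>t. t *\<^sub>R x) ` {0..}"
  have cl: "closed ?ray"
  proof (rule closed_injective_linear_image)
    show "linear (\<lambda>t. t *\<^sub>R x)" by (auto simp: linear_iff scaleR_add_left)
    show "inj (\<lambda>t. t *\<^sub>R x)" using assms(3) by (auto simp: inj_def)
  qed simp
  have cv: "convex ?ray"
    by (rule convex_linear_image) (auto simp: linear_iff scaleR_add_left)
  have "?ray \<inter> convex hull E = {}"
    using miss by auto
  then have "\<exists>a b. (\<forall>p\<in>?ray. a \<bullet> p < b) \<and> (\<forall>p\<in>convex hull E. b < a \<bullet> p)"
    using False by (intro separating_hyperplane_closed_compact cv cl convex_convex_hull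
        compact_convex_hull assms(1)) auto
  then obtain a b where ab: "\<forall>p\<in>?ray. a \<bullet> p < b" "\<forall>p\<in>convex hull E. b < a \<bullet> p"
    by (elim exE conjE)
  from ab(1) have "b > 0"
    by (metis atLeast_iff imageI inner_zero_right order_refl scaleR_zero_left)
  have ax: "a \<bullet> x \<le> 0"
  proof (rule ccontr)
    assume "\<not> a \<bullet> x \<le> 0"
    then have pos: "a \<bullet> x > 0"
      by simp
    then have "(b / (a \<bullet> x)) *\<^sub>R x \<in> ?ray"
      using \<open>b > 0\<close> by auto
    from bspec[OF ab(1) this] have "(b / (a \<bullet> x)) * (a \<bullet> x) < b"
      by (simp only: inner_scaleR_right)
    with pos show False
      by simp
  qed
  let ?a = "a - (b / 2) *\<^sub>R x"
  have "?a \<bullet> x < 0"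
    using ax \<open>b > 0\<close> assms(3) by (simp add: inner_diff_left inner_unit_self)
  moreover have "0 < ?a \<bullet> e" if "e \<in> E" for e
  proof -
    have "b < a \<bullet> e"
      by (rule bspec[OF ab(2) hull_inc[OF that]])
    moreover have "(b / 2) * (x \<bullet> e) \<le> (b / 2) * 1"
      using inner_unit_bounds[of x e] assms(2)[OF that] assms(3) \<open>b > 0\<close>
      by (intro mult_left_mono) auto
    ultimately show ?thesis
      using \<open>b > 0\<close> unfolding inner_diff_left inner_scaleR_left by linarith
  qed
  ultimately show ?thesis
    by blast
qed

lemma closedin_S2_compact:
  assumes "closedin (top_of_set S2) C"
  shows "compact C"
  using closedin_compact[OF _ assms] by simp

lemma open_hemisphere_around:
  assumes "sph_convex C" "compact C"
  shows "\<exists>w. \<forall>x\<in>C. 0 < w \<bullet> x"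
proof (cases "C = {}")
  case False
  have "0 \<notin> convex hull C"
    using hull_on_rays[OF assms(1), of 0] by auto
  moreover have "closed (convex hull C)"
    using compact_convex_hull[OF assms(2)] by (rule compact_imp_closed)
  ultimately obtain a b where ab: "a \<bullet> 0 < b" "\<forall>x\<in>convex hull C. b < a \<bullet> x"
    using separating_hyperplane_closed_point[of "convex hull C" 0] by (auto simp: convex_convex_hull)
  have "0 < a \<bullet> x" if "x \<in> C" for x
    using bspec[OF ab(2) hull_inc[OF that]] ab(1) by simp
  then show ?thesis by blast
qed simp

lemma bipolar:
  assumes "sph_convex C" "compact C" "norm x = 1" and pos: "\<And>y. y \<in> polar C \<Longrightarrow> 0 \<le> y \<bullet> x"
  shows "x \<in> C"
proof (rule ccontr)
  assume "x \<notin> C"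
  have "t *\<^sub>R x \<notin> convex hull C" if "0 \<le> t" for t
  proof
    assume "t *\<^sub>R x \<in> convex hull C"
    from hull_on_rays[OF assms(1) this] have "t *\<^sub>R x \<noteq> 0" "sgn (t *\<^sub>R x) \<in> C" by auto
    with that have "sgn x \<in> C" by (auto simp: sgn_scaleR)
    with assms(3) \<open>x \<notin> C\<close> show False by (simp add: sgn_div_norm)
  qed
  with separate_ray_from_hull[OF assms(2) _ assms(3)] sph_convexD[OF assms(1)]
  obtain a where a: "a \<bullet> x < 0" "\<forall>e\<in>C. 0 < a \<bullet> e" by blast
  then have "a \<noteq> 0" by auto
  then have "sgn a \<in> polar C"
    using a sgn_in_S2[of a] by (auto simp: polar_def inner_sgn intro!: divide_nonneg_nonneg less_imp_le)
  from pos[OF this] a \<open>a \<noteq> 0\<close> show False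
    by (simp add: inner_sgn field_simps)
qed

lemma compact_polar: "compact (polar C)"
proof -
  have "polar C = S2 \<inter> (\<Inter>x\<in>C. {k. 0 \<le> k \<bullet> x})"
    by (auto simp: polar_def)
  moreover have "closed (\<Inter>x\<in>C. {k. 0 \<le> k \<bullet> x})"
    by (intro closed_INT ballI closed_Collect_le continuous_intros)
  ultimately show ?thesis
    by (simp add: compact_Int_closed)
qed

text \<open>If \<open>x\<close> were on the boundary of the hemisphere of \<open>y\<close>, a short step from \<open>x\<close> in the direction
  \<open>- y\<close> would stay in \<open>C\<close> and leave the hemisphere.\<close>

lemma polar_pos_on_interior:
  assumes "C \<subseteq> S2" "x \<in> sph_interior C" "y \<in> polar C"
  shows "0 < y \<bullet> x"
proof -
  from assms(2) obtain T where "openin (top_of_set S2) T" "x \<in> T" "T \<subseteq> C"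
    by (auto simp: sph_interior_def interior_of_def)
  then obtain e where "e > 0" and e: "ball x e \<inter> S2 \<subseteq> C" and xC: "x \<in> C" and x1: "norm x = 1"
    unfolding openin_contains_ball by (metis (no_types, lifting) assms(1) mem_sphere_0 order_trans subsetD)
  show ?thesis
  proof (rule ccontr)
    assume "\<not> 0 < y \<bullet> x"
    then have yx: "y \<bullet> x = 0" using polarD[OF assms(3) xC] by simp
    have y1: "norm y = 1" using assms(3) by (rule polar_norm)
    define t where "t = min (e / 2) 1"
    have t: "0 < t" "t < e" using \<open>e > 0\<close> by (auto simp: t_def)
    (* the point at distance t from x on the great circle through x and - y *)
    define z where "z = cos t *\<^sub>R x - sin t *\<^sub>R y"
    have "t < pi" using pi_gt3 by (auto simp: t_def)
    then have sint: "0 < sin t" using t by (intro sin_gt_zero)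
    have zz: "norm z = 1"
      unfolding norm_eq_1 z_def using yx inner_unit_self[OF x1] inner_unit_self[OF y1]
      by (simp add: inner_diff_left inner_diff_right inner_commute flip: power2_eq_square)
    have "(norm (x - z))\<^sup>2 = 2 - 2 * cos t"
      using zz x1 yx inner_unit_self[OF x1] inner_unit_self[OF zz] 
      by (simp add: power2_norm_eq_inner inner_diff_left inner_diff_right inner_commute)
        (simp add: z_def inner_diff_left inner_diff_right inner_commute)
    also have "\<dots> = (2 * sin (t / 2))\<^sup>2"
      using cos_double_sin[of "t / 2"] by (simp add: power_mult_distrib)
    also have "\<dots> \<le> t\<^sup>2"
    proof (rule power_mono)
      show "2 * sin (t / 2) \<le> t" using sin_x_le_x[of "t/2"] t by simp
      show "0 \<le> 2 * sin (t / 2)" using t \<open>t < pi\<close> by (simp add: sin_ge_zero)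
    qed
    finally have "norm (x - z) \<le> t" using t by (meson less_imp_le norm_ge_zero power2_le_imp_le)
    then have "z \<in> C" using e zz t by (auto simp: dist_norm)
    from polarD[OF assms(3) this] have "0 \<le> y \<bullet> z" .
    also have "y \<bullet> z = - sin t"
      using yx inner_unit_self[OF y1] by (simp add: z_def inner_diff_right)
    finally show False using sint by simp
  qed
qed

locale body =
  fixes C :: "(real^3) set"
  assumes convex_body: "sph_convex_body C"
begin

lemma conv: "sph_convex C" and cpt: "compact C"
  using convex_body closedin_S2_compact by (auto simp: sph_convex_body_def)

lemma norm_1: "a \<in> C \<Longrightarrow> norm a = 1"
  using sph_convexD[OF conv] by auto

lemma interior_point: "\<exists>x\<in>C. \<forall>y\<in>polar C. 0 < y \<bullet> x"
proof -
  from convex_body obtain x where x: "x \<in> sph_interior C" by (auto simp: sph_convex_body_def)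
  moreover have "sph_interior C \<subseteq> C" by (simp add: sph_interior_def interior_of_subset)
  ultimately show ?thesis using polar_pos_on_interior[OF sph_convexD(1)[OF conv] x] by auto
qed

text \<open>The polar is compact, so the products have a positive minimum \<open>m\<close>, and the ball of radius \<open>m\<close>
  around \<open>x\<close> stays in every hemisphere that contains \<open>C\<close>.\<close>

lemma interior_if_polar_pos:
  assumes "norm x = 1" "\<And>y. y \<in> polar C \<Longrightarrow> 0 < y \<bullet> x"
  shows "x \<in> sph_interior C"
proof -
  obtain m where m: "0 < m" "\<And>y. y \<in> polar C \<Longrightarrow> m \<le> y \<bullet> x"
  proof (cases "polar C = {}")
    case True
    then show ?thesis using that[of 1] by simp
  next
    case False
    have "continuous_on (polar C) (\<lambda>y. y \<bullet> x)" by (intro continuous_intros)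
    from continuous_attains_inf[OF compact_polar False this] show ?thesis
      using that assms(2) by blast
  qed
  have "S2 \<inter> ball x m \<subseteq> C"
  proof
    fix z assume z: "z \<in> S2 \<inter> ball x m"
    show "z \<in> C"
    proof (rule bipolar[OF conv cpt])
      show "norm z = 1" using z by simp
      fix y assume y: "y \<in> polar C"
      have "y \<bullet> (x - z) \<le> norm (x - z)"
        using norm_cauchy_schwarz[of y "x - z"] polar_norm[OF y] by simp
      also have "\<dots> < m" using z by (simp add: dist_norm)
      finally show "0 \<le> y \<bullet> z" using m(2)[OF y] by (simp add: inner_diff_right)
    qed
  qed
  moreover have "openin (top_of_set S2) (S2 \<inter> ball x m)" by (intro openin_open_Int) simp
  moreover have "x \<in> S2 \<inter> ball x m" using assms m by simp
  ultimately show ?thesis by (auto simp: sph_interior_def interior_of_def)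
qed

lemma sph_convex_polar: "sph_convex (polar C)"
  unfolding sph_convex_def
proof (intro conjI ballI)
  show "polar C \<subseteq> S2" by (auto simp: polar_def)
  obtain x where x: "x \<in> C" "\<And>y. y \<in> polar C \<Longrightarrow> 0 < y \<bullet> x" using interior_point by auto
  show "- a \<notin> polar C" if "a \<in> polar C" for a
    using x(2)[of a] x(2)[of "- a"] that by auto
  show "sph_arc a b \<subseteq> polar C" if "a \<in> polar C" "b \<in> polar C" for a b
    using that by (auto simp: sph_arc_def polar_def inner_add_left)
qed

lemma polar_nonempty: "polar C \<noteq> {}"
proof -
  obtain w where w: "\<And>x. x \<in> C \<Longrightarrow> 0 < w \<bullet> x"
    using open_hemisphere_around[OF conv cpt] by auto
  obtain x where "x \<in> C" using interior_point by auto
  with w have "w \<noteq> 0" by fastforce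
  then have "sgn w \<in> polar C"
    using w sgn_in_S2[of w] by (auto simp: polar_def inner_sgn intro!: divide_nonneg_nonneg less_imp_le)
  then show ?thesis by auto
qed

text \<open>A polar with one point only would make the body a hemisphere.\<close>

lemma polar_not_singleton: "polar C \<noteq> {k}"
proof
  assume eq: "polar C = {k}"
  then have k1: "norm k = 1" using polar_norm by auto
  obtain v :: "real^3" where v: "v \<noteq> 0" "orthogonal v k"
    using orthogonal_to_vector_exists[of k] by (auto simp: orthogonal_commute)
  have "sgn v \<in> C" "- sgn v \<in> C"
    using v by (auto intro!: bipolar[OF conv cpt] simp: eq norm_sgn inner_sgn orthogonal_def inner_commute)
  then show False using sph_convexD[OF conv] by auto
qed

end

text \<open>The first-order condition at a point \<open>l\<close> of \<open>K\<close> farthest from \<open>k\<close>: the move from \<open>l\<close> towards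
  \<open>y\<close> cannot decrease \<open>k \<bullet> l\<close>. In other words \<open>k - (k \<bullet> l) l\<close>, the component of \<open>k\<close> orthogonal to \<open>l\<close>, is
  non-negative on \<open>K\<close>. This makes the centers of the semicircles of a thinnest lune points of the
  body.\<close>

lemma minimal_inner_variation:
  assumes "sph_convex K" "l \<in> K" and min: "\<forall>y\<in>K. k \<bullet> l \<le> k \<bullet> y" and y: "y \<in> K"
  shows "(k \<bullet> l) * (l \<bullet> y) \<le> k \<bullet> y"
proof -
  have l1: "norm l = 1" "norm y = 1" using assms sph_convexD(2) by auto
  note n = inner_unit_self[OF l1(1)] inner_unit_self[OF l1(2)]
  have step: "(k \<bullet> l) * norm (l + e *\<^sub>R y) \<le> k \<bullet> l + e * (k \<bullet> y)" if "0 < e" for e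
  proof -
    have *: "1 *\<^sub>R l + e *\<^sub>R y \<noteq> 0" "sgn (1 *\<^sub>R l + e *\<^sub>R y) \<in> K"
      using conic_combination[OF assms(1,2) y, of 1 e] that by auto
    from bspec[OF min *(2)] *(1) show ?thesis
      by (simp add: inner_sgn inner_add_right field_simps)
  qed
  show ?thesis
  proof (cases "0 \<le> k \<bullet> l")
    case True
    have "1 + l \<bullet> y \<le> norm (l + 1 *\<^sub>R y)"
      using norm_cauchy_schwarz[of l "l + y"] l1 n by (simp add: inner_add_right)
    from mult_left_mono[OF this True] step[of 1] show ?thesis by (simp add: algebra_simps)
  next
    case False
    have le: "(k \<bullet> l) * (l \<bullet> y) \<le> k \<bullet> y + e" if e: "0 < e" for e
    proof -
      (* a step d makes the second-order term contribute exactly e per unit of the step *)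
      define d where "d = 2 * e / - (k \<bullet> l)"
      have d: "0 < d" "- (k \<bullet> l) * d = 2 * e" using False e by (auto simp: d_def field_simps)
      have "norm (l + d *\<^sub>R y) \<le> 1 + d * (l \<bullet> y) + d\<^sup>2 / 2"
      proof -
        have sq: "(norm (l + d *\<^sub>R y))\<^sup>2 = 1 + 2 * (d * (l \<bullet> y) + d\<^sup>2 / 2)"
          by (simp add: power2_norm_eq_inner inner_add_left inner_add_right n inner_commute[of y l])
            (simp add: power2_eq_square algebra_simps)
        have "0 \<le> (norm (l + d *\<^sub>R y) - 1)\<^sup>2" by simp
        then show ?thesis using sq by (simp add: power2_diff)
      qed
      from mult_left_mono_neg[OF this, of "k \<bullet> l"] step[OF d(1)] False
      have "(k \<bullet> l) * (d * (l \<bullet> y) + d\<^sup>2 / 2) \<le> d * (k \<bullet> y)" by (simp add: algebra_simps)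
      then have "d * ((k \<bullet> l) * (l \<bullet> y) - e) \<le> d * (k \<bullet> y)"
        using arg_cong[OF d(2), of "\<lambda>x. x * d"] by (simp add: algebra_simps power2_eq_square)
      then show ?thesis using d(1) by simp
    qed
    show ?thesis by (rule field_le_epsilon) (use le in auto)
  qed
qed

section \<open>Thickness through the polar\<close>

text \<open>Three orthonormal vectors are a basis, so the difference of the two sides is orthogonal to everything.\<close>

lemma orthonormal_expansion:
  fixes p r t x :: "real^3"
  assumes "norm p = 1" "norm r = 1" "norm t = 1" "p \<bullet> r = 0" "p \<bullet> t = 0" "r \<bullet> t = 0"
  shows "x = (x \<bullet> p) *\<^sub>R p + (x \<bullet> r) *\<^sub>R r + (x \<bullet> t) *\<^sub>R t"
proof -
  let ?B = "{p, r, t}"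
  note u = inner_unit_self[OF assms(1)] inner_unit_self[OF assms(2)] inner_unit_self[OF assms(3)]
  have ne: "p \<noteq> r" "p \<noteq> t" "r \<noteq> t" "p \<noteq> 0" "r \<noteq> 0" "t \<noteq> 0"
    using assms u by auto
  have "independent ?B"
    using assms ne by (intro pairwise_orthogonal_independent) (auto simp: pairwise_def orthogonal_def inner_commute)
  moreover have "card ?B = DIM(real^3)"
    using ne by simp
  ultimately have sp: "span ?B = UNIV"
    by (metis card_ge_dim_independent dim_UNIV order_refl subset_UNIV top.extremum_uniqueI)
  define y where "y = x - ((x \<bullet> p) *\<^sub>R p + (x \<bullet> r) *\<^sub>R r + (x \<bullet> t) *\<^sub>R t)"
  have "orthogonal y b" if "b \<in> ?B" for b
    using that assms u by (auto simp: y_def orthogonal_def inner_diff_left inner_add_left inner_commute[of r p] inner_commute[of t p] inner_commute[of t r])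
  then have "orthogonal y y"
    using orthogonal_to_span[of y ?B y] sp by (auto simp: orthogonal_commute)
  then have "y = 0" by (simp add: orthogonal_self)
  then show ?thesis by (simp add: y_def)
qed

lemma orthonormal_inner:
  fixes p r t x y :: "real^3"
  assumes "norm p = 1" "norm r = 1" "norm t = 1" "p \<bullet> r = 0" "p \<bullet> t = 0" "r \<bullet> t = 0"
  shows "x \<bullet> y = (x \<bullet> p) * (y \<bullet> p) + (x \<bullet> r) * (y \<bullet> r) + (x \<bullet> t) * (y \<bullet> t)"
proof -
  have "x \<bullet> y = ((x \<bullet> p) *\<^sub>R p + (x \<bullet> r) *\<^sub>R r + (x \<bullet> t) *\<^sub>R t) \<bullet> y"
    using orthonormal_expansion[OF assms, of x] by simp
  also have "\<dots> = (x \<bullet> p) * (p \<bullet> y) + (x \<bullet> r) * (r \<bullet> y) + (x \<bullet> t) * (t \<bullet> y)"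
    by (simp only: inner_add_left inner_scaleR_left)
  finally show ?thesis by (simp only: inner_commute[of _ y])
qed

lemma obtain_orthogonal_unit:
  fixes a b :: "real^3"
  obtains p where "norm p = 1" "p \<bullet> a = 0" "p \<bullet> b = 0"
proof -
  have "dim {a, b} \<le> card {a, b}" by (rule dim_le_card') simp
  also have "\<dots> \<le> 2" by (simp add: card_insert_if)
  finally have "dim {a, b} < DIM(real^3)" by simp
  then obtain x where x: "x \<noteq> 0" "\<And>y. y \<in> span {a, b} \<Longrightarrow> orthogonal x y"
    using orthogonal_to_subspace_exists by blast
  have "x \<bullet> a = 0" "x \<bullet> b = 0"
    using x(2) by (auto simp: orthogonal_def span_base)
  then show ?thesis
    using that[of "sgn x"] x(1) by (simp add: norm_sgn inner_sgn)
qed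

lemma hemisphere_eq: "k \<in> S2 \<Longrightarrow> hemisphere k = {x \<in> S2. 0 \<le> k \<bullet> x}"
proof -
  assume k: "k \<in> S2"
  have "(arccos (k \<bullet> x) \<le> pi / 2) = (0 \<le> k \<bullet> x)" if "norm x = 1" for x
    using arccos_le_mono[of "k \<bullet> x" 0] inner_unit_bounds[of k x] k that by (simp add: abs_le_iff)
  then show ?thesis by (auto simp: hemisphere_def disk_def sph_dist_def)
qed

lemma subset_hemisphere_iff: "C \<subseteq> S2 \<Longrightarrow> (k \<in> S2 \<and> C \<subseteq> hemisphere k) = (k \<in> polar C)"
  by (auto simp: hemisphere_eq polar_def)

lemma bd_closed: "closedin (top_of_set S2) C \<Longrightarrow> bd C = C - sph_interior C"
  unfolding bd_def sph_interior_def frontier_of_def closure_of_eq by (rule arg_cong2[where f = minus]) (auto simp: closure_of_eq)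

lemma bd_hemisphere:
  assumes "k \<in> S2"
  shows "bd (hemisphere k) = {x \<in> S2. k \<bullet> x = 0}"
proof -
  have "closed {x. 0 \<le> k \<bullet> x}"
    by (intro closed_Collect_le continuous_intros)
  then have "closedin (top_of_set S2) (S2 \<inter> {x. 0 \<le> k \<bullet> x})"
    by (rule closedin_closed_Int)
  moreover have eq: "hemisphere k = S2 \<inter> {x. 0 \<le> k \<bullet> x}"
    unfolding hemisphere_eq[OF assms] by blast
  ultimately have bd: "bd (hemisphere k) = hemisphere k - sph_interior (hemisphere k)"
    using bd_closed by simp
  have "k \<in> polar (hemisphere k)"
    using assms eq by (auto simp: polar_def)
  then have "0 < k \<bullet> x" if "x \<in> sph_interior (hemisphere k)" for x
    using polar_pos_on_interior[OF _ that] eq by auto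
  moreover have "x \<in> sph_interior (hemisphere k)" if "x \<in> S2" "0 < k \<bullet> x" for x
  proof -
    have "open {x. 0 < k \<bullet> x}"
      by (intro open_Collect_less continuous_intros)
    then have "openin (top_of_set S2) (S2 \<inter> {x. 0 < k \<bullet> x})"
      by (rule openin_open_Int)
    then show ?thesis
      using that eq by (force simp: sph_interior_def interior_of_def)
  qed
  ultimately show ?thesis
    unfolding bd unfolding eq by force
qed

text \<open>The center is the midpoint of the semicircle, which is \<open>h\<close> projected orthogonally to the plane
  of \<open>bd (hemisphere g)\<close> and normalized. For uniqueness, take the end-points \<open>\<plusminus>p\<close> of the semicircle:
  a point equidistant from them is orthogonal to \<open>p\<close>, which leaves two points, and only one of them
  is in the hemisphere of \<open>h\<close>.\<close>

lemma semicircle_center_eq: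
  assumes "forms_lune g h"
  shows "semicircle_center (bd (hemisphere g) \<inter> hemisphere h) = sgn (h - (g \<bullet> h) *\<^sub>R g)"
proof -
  have g: "g \<in> S2" "norm g = 1" and h: "h \<in> S2" "norm h = 1" and ne: "g \<noteq> h" "g \<noteq> - h"
    using assms by (auto simp: forms_lune_def)
  define c where "c = g \<bullet> h"
  have c: "- 1 < c" "c < 1"
    using inner_unit_bounds[OF g(2) h(2)] inner_unit_eq_1[OF g(2) h(2)] inner_unit_eq_minus_1[OF g(2) h(2)] ne
    unfolding c_def by force+
  then have c2: "0 < 1 - c * c"
    by (metis abs_less_iff abs_square_less_1 diff_gt_0_iff_gt minus_less_iff power2_eq_square)
  note u = inner_unit_self[OF g(2)] inner_unit_self[OF h(2)]
  define f where "f = h - c *\<^sub>R g"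
  have fh: "h \<bullet> f = 1 - c * c" and fg: "g \<bullet> f = 0"
    by (simp_all add: f_def inner_diff_right u c_def inner_commute)
  have f0: "f \<noteq> 0" using fh c2 by auto
  define m where "m = sgn f"
  have m1: "norm m = 1" and mg: "g \<bullet> m = 0" and mh: "0 < h \<bullet> m"
    using f0 fg fh c2 by (simp_all add: m_def norm_sgn inner_sgn)
  let ?S = "bd (hemisphere g) \<inter> hemisphere h"
  have S: "?S = {x \<in> S2. g \<bullet> x = 0 \<and> 0 \<le> h \<bullet> x}"
    unfolding bd_hemisphere[OF g(1)] unfolding hemisphere_eq[OF h(1)] by blast
  have "semicircle_center ?S = m"
    unfolding semicircle_center_def
  proof (rule the_equality)
    show "m \<in> ?S \<and> (\<forall>p. p \<in> ?S \<and> - p \<in> ?S \<longrightarrow> sph_dist m p = sph_dist m (- p))"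
    proof (intro conjI allI impI)
      show "m \<in> ?S" unfolding S using m1 mg mh by simp
      fix p assume "p \<in> ?S \<and> - p \<in> ?S"
      then have "g \<bullet> p = 0" "h \<bullet> p = 0" unfolding S by auto
      then have "m \<bullet> p = 0" by (simp add: m_def f_def inner_sgn inner_diff_left)
      then show "sph_dist m p = sph_dist m (- p)" by (simp add: sph_dist_def)
    qed
  next
    fix x assume x: "x \<in> ?S \<and> (\<forall>p. p \<in> ?S \<and> - p \<in> ?S \<longrightarrow> sph_dist x p = sph_dist x (- p))"
    then have x1: "norm x = 1" and xg: "g \<bullet> x = 0" and xh: "0 \<le> h \<bullet> x" unfolding S by auto
    obtain p where p: "norm p = 1" "p \<bullet> g = 0" "p \<bullet> h = 0" by (rule obtain_orthogonal_unit)
    then have "p \<in> ?S" "- p \<in> ?S" unfolding S by (auto simp: inner_commute)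
    with x have "arccos (x \<bullet> p) = arccos (- (x \<bullet> p))" by (auto simp: sph_dist_def)
    then have "x \<bullet> p = - (x \<bullet> p)"
      using inner_unit_bounds[OF x1 p(1)] by (subst (asm) arccos_eq_iff) auto
    then have xp: "x \<bullet> p = 0" by simp
    have mp: "m \<bullet> p = 0" using p by (simp add: m_def f_def inner_sgn inner_diff_left inner_commute[of h p] inner_commute[of g p])
    have "x = (x \<bullet> g) *\<^sub>R g + (x \<bullet> m) *\<^sub>R m + (x \<bullet> p) *\<^sub>R p"
      by (rule orthonormal_expansion) (use g m1 p mg mp in \<open>auto simp: inner_commute\<close>)
    then have xm: "x = (x \<bullet> m) *\<^sub>R m" using xg xp by (simp add: inner_commute)
    then have "\<bar>x \<bullet> m\<bar> = 1" using x1 m1 by (metis mult.right_neutral norm_scaleR)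
    moreover have "0 \<le> (x \<bullet> m) * (h \<bullet> m)" using xh xm by (metis inner_scaleR_right)
    ultimately have "x \<bullet> m = 1" using mh by (auto simp: zero_le_mult_iff abs_if split: if_splits)
    with xm show "x = m" by simp
  qed
  then show ?thesis by (simp add: m_def f_def c_def)
qed

lemma lune_thickness_eq:
  assumes "forms_lune g h"
  shows "lune_thickness g h = arccos (- (g \<bullet> h))"
proof -
  have g: "norm g = 1" and h: "norm h = 1" and ne: "g \<noteq> h" "g \<noteq> - h" and fl: "forms_lune h g"
    using assms by (auto simp: forms_lune_def)
  define c where "c = g \<bullet> h"
  have "- 1 < c" "c < 1"
    using inner_unit_bounds[OF g h] inner_unit_eq_1[OF g h] inner_unit_eq_minus_1[OF g h] ne
    unfolding c_def by force+
  then have c2: "0 < 1 - c * c"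
    by (metis abs_less_iff abs_square_less_1 diff_gt_0_iff_gt minus_less_iff power2_eq_square)
  note u = inner_unit_self[OF g] inner_unit_self[OF h]
  let ?f = "h - c *\<^sub>R g" and ?e = "g - c *\<^sub>R h"
  have nf: "norm ?f = sqrt (1 - c * c)" "norm ?e = sqrt (1 - c * c)"
    by (simp_all add: norm_eq_sqrt_inner inner_diff_left inner_diff_right u inner_commute[of h g] flip: c_def)
  have "?f \<bullet> ?e = - c * (1 - c * c)"
    by (simp add: inner_diff_left inner_diff_right u inner_commute[of h g] algebra_simps flip: c_def)
  then have "sgn ?f \<bullet> sgn ?e = - c"
    using c2 by (simp add: inner_sgn nf)
  moreover have "lune_thickness g h = arccos (sgn ?f \<bullet> sgn ?e)"
    unfolding lune_thickness_def sph_dist_def semicircle_center_eq[OF assms] semicircle_center_eq[OF fl]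
    by (simp add: c_def inner_commute[of h g])
  ultimately show ?thesis by (simp add: c_def)
qed

context body
begin

lemma supports_iff: "supports k C \<longleftrightarrow> k \<in> polar C \<and> (\<exists>x\<in>C. k \<bullet> x = 0)"
proof -
  have "bd C = C - sph_interior C"
    using convex_body bd_closed by (auto simp: sph_convex_body_def)
  then show ?thesis
    using subset_hemisphere_iff[OF sph_convexD(1)[OF conv], of k]
      polar_pos_on_interior[OF sph_convexD(1)[OF conv], of _ k] bd_hemisphere[of k] sph_convexD(1)[OF conv]
    unfolding supports_def by (fastforce simp: polar_def)
qed

text \<open>The point in \<open>C\<close> is the center of the semicircle in which the boundary of the hemisphere of
  \<open>l\<close> bounds the lune. Strictness excludes \<open>l = k\<close> because then the polar would be a single point.\<close>

lemma farthest_in_polar: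
  assumes k: "k \<in> polar C" and l: "l \<in> polar C" and min: "\<forall>y\<in>polar C. k \<bullet> l \<le> k \<bullet> y"
  shows "- 1 < k \<bullet> l" "k \<bullet> l < 1" "sgn (k - (k \<bullet> l) *\<^sub>R l) \<in> C"
    "(k - (k \<bullet> l) *\<^sub>R l) \<bullet> l = 0"
    "norm (k - (k \<bullet> l) *\<^sub>R l) = sqrt (1 - (k \<bullet> l)\<^sup>2)"
proof -
  have n: "norm k = 1" "norm l = 1" using k l polar_norm by auto
  note u = inner_unit_self[OF n(1)] inner_unit_self[OF n(2)]
  have "k \<bullet> l \<noteq> -1"
    using inner_unit_eq_minus_1[OF n] sph_convexD(3)[OF sph_convex_polar l] k by auto
  moreover have "k \<bullet> l \<noteq> 1"
  proof
    assume "k \<bullet> l = 1"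
    then have "y = k" if "y \<in> polar C" for y
    proof -
      have "k \<bullet> y = 1"
        using bspec[OF min that] inner_unit_bounds(2)[OF n(1) polar_norm[OF that]] \<open>k \<bullet> l = 1\<close> by linarith
      from inner_unit_eq_1[OF n(1) polar_norm[OF that] this] show ?thesis by simp
    qed
    then have "polar C \<subseteq> {k}" by blast
    then have "polar C = {k}" using k by blast
    then show False using polar_not_singleton by auto
  qed
  ultimately show c: "- 1 < k \<bullet> l" "k \<bullet> l < 1" using inner_unit_bounds[OF n] by auto
  let ?f = "k - (k \<bullet> l) *\<^sub>R l"
  show 0: "?f \<bullet> l = 0" by (simp add: inner_diff_left u)
  show nf: "norm ?f = sqrt (1 - (k \<bullet> l)\<^sup>2)"
    by (simp add: norm_eq_sqrt_inner inner_diff_left inner_diff_right u inner_commute[of l k] power2_eq_square)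
  have "(k \<bullet> l)\<^sup>2 < 1" using c by (simp add: abs_square_less_1 abs_less_iff)
  then have "?f \<noteq> 0" using nf by auto
  show "sgn ?f \<in> C"
  proof (rule bipolar[OF conv cpt])
    show "norm (sgn ?f) = 1" using \<open>?f \<noteq> 0\<close> by (simp add: norm_sgn)
    fix y assume y: "y \<in> polar C"
    have "0 \<le> y \<bullet> ?f"
      using minimal_inner_variation[OF sph_convex_polar l min y]
      by (simp add: inner_diff_right inner_commute)
    then show "0 \<le> y \<bullet> sgn ?f" by (simp add: inner_sgn)
  qed
qed

text \<open>Hence the infimum that defines the width is over a non-empty set and is governed by the whole polar, although only centers of supporting hemispheres enter it.\<close>

lemma support_opposite:
  assumes k: "k \<in> polar C" and l: "l \<in> polar C" and min: "\<forall>y\<in>polar C. k \<bullet> l \<le> k \<bullet> y"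
  shows "supports l C" "forms_lune k l"
proof -
  note f = farthest_in_polar[OF assms]
  show "supports l C"
    unfolding supports_iff using l f(3,4) by (auto simp: inner_sgn inner_commute[of l] intro!: bexI[OF _ f(3)])
  have "norm k = 1" "norm l = 1" using k l polar_norm by auto
  then show "forms_lune k l"
    unfolding forms_lune_def using f(1,2) inner_unit_self by force
qed

text \<open>The thickness is \<open>\<pi>\<close> minus the diameter of the polar. A farthest pair of the polar
  automatically consists of centers of supporting hemispheres.\<close>

lemma thickness_attained:
  "\<exists>k\<in>polar C. \<exists>l\<in>polar C. thickness C = arccos (- (k \<bullet> l)) \<and> - 1 < k \<bullet> l \<and> k \<bullet> l < 1 \<and>
     (\<forall>k'\<in>polar C. \<forall>l'\<in>polar C. k \<bullet> l \<le> k' \<bullet> l')"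
proof -
  have "compact (polar C \<times> polar C)" "polar C \<times> polar C \<noteq> {}"
    using compact_polar polar_nonempty by (auto intro: compact_Times)
  moreover have "continuous_on (polar C \<times> polar C) (\<lambda>(k, l). k \<bullet> l)"
    by (auto simp: case_prod_unfold intro!: continuous_intros)
  ultimately have "\<exists>q\<in>polar C \<times> polar C. \<forall>p\<in>polar C \<times> polar C.
      (\<lambda>(k, l). k \<bullet> l) q \<le> (\<lambda>(k, l). k \<bullet> l) p"
    by (rule continuous_attains_inf)
  then obtain k l where k: "k \<in> polar C" and l: "l \<in> polar C"
    and min: "\<And>k' l'. k' \<in> polar C \<Longrightarrow> l' \<in> polar C \<Longrightarrow> k \<bullet> l \<le> k' \<bullet> l'" by auto
  have mink: "\<forall>y\<in>polar C. k \<bullet> l \<le> k \<bullet> y" and minl: "\<forall>y\<in>polar C. l \<bullet> k \<le> l \<bullet> y"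
    using min k l by (auto simp: inner_commute[of l])
  note s = support_opposite[OF k l mink] support_opposite[OF l k minl]
  let ?T = "\<lambda>k. {k'. supports k' C \<and> forms_lune k k'}"
  let ?a = "arccos (- (k \<bullet> l))"
  have lb: "?a \<le> lune_thickness k1 k2" if "supports k1 C" "k2 \<in> ?T k1" for k1 k2
  proof -
    have "k1 \<in> polar C" "k2 \<in> polar C" "forms_lune k1 k2" using that supports_iff by auto
    then show ?thesis
      using min[of k1 k2] inner_unit_bounds[of k1 k2] inner_unit_bounds[of k l] polar_norm k l
      by (simp add: lune_thickness_eq) (rule arccos_le_arccos; force)
  qed
  have ne: "?T k1 \<noteq> {}" if "supports k1 C" for k1
  proof -
    have k1: "k1 \<in> polar C" using that supports_iff by auto
    have "continuous_on (polar C) (\<lambda>y. k1 \<bullet> y)" by (intro continuous_intros)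
    from continuous_attains_inf[OF compact_polar polar_nonempty this]
    obtain l1 where "l1 \<in> polar C" "\<forall>y\<in>polar C. k1 \<bullet> l1 \<le> k1 \<bullet> y" by blast
    from support_opposite[OF k1 this] show ?thesis by auto
  qed
  have wlb: "?a \<le> width k1 C" if "supports k1 C" for k1
    unfolding width_def by (rule cINF_greatest[OF ne[OF that]]) (rule lb[OF that])
  have "width k C \<le> lune_thickness k l"
    unfolding width_def
    by (rule cINF_lower) (use lb[OF s(3)] s in \<open>auto intro!: bdd_belowI2\<close>)
  then have "width k C \<le> ?a" using lune_thickness_eq[OF s(2)] by simp
  moreover have "thickness C \<le> width k C"
    unfolding thickness_def by (rule cINF_lower) (use wlb s in \<open>auto intro!: bdd_belowI2\<close>)
  moreover have "?a \<le> thickness C"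
    unfolding thickness_def by (rule cINF_greatest) (use wlb s in auto)
  ultimately have "thickness C = ?a" by simp
  with k l farthest_in_polar(1,2)[OF k l mink] min show ?thesis by blast
qed

lemma thickness_bounds: "0 < thickness C" "thickness C < pi"
proof -
  obtain k l where "k \<in> polar C" "thickness C = arccos (- (k \<bullet> l))" "- 1 < k \<bullet> l" "k \<bullet> l < 1"
    using thickness_attained by (elim bexE conjE)
  then show "0 < thickness C" "thickness C < pi"
    using arccos_lt_bounded[of "- (k \<bullet> l)"] by auto
qed

lemma polar_inner_attained:
  "\<exists>k\<in>polar C. \<exists>l\<in>polar C. k \<bullet> l = - cos (thickness C) \<and>
     (\<forall>k'\<in>polar C. \<forall>l'\<in>polar C. k \<bullet> l \<le> k' \<bullet> l')"
proof -
  obtain k l where kl: "k \<in> polar C" "l \<in> polar C" "thickness C = arccos (- (k \<bullet> l))"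
      "- 1 < k \<bullet> l" "k \<bullet> l < 1" and min: "\<forall>k'\<in>polar C. \<forall>l'\<in>polar C. k \<bullet> l \<le> k' \<bullet> l'"
    using thickness_attained by (elim bexE conjE)
  then have "k \<bullet> l = - cos (thickness C)" by (simp add: cos_arccos)
  with kl(1,2) min show ?thesis by blast
qed

lemma polar_inner_ge: "k \<in> polar C \<Longrightarrow> l \<in> polar C \<Longrightarrow> - cos (thickness C) \<le> k \<bullet> l"
  using polar_inner_attained by fastforce

lemma sph_diam_attained:
  "\<exists>a\<in>C. \<exists>b\<in>C. sph_diam C = arccos (a \<bullet> b) \<and> (\<forall>x\<in>C. \<forall>y\<in>C. a \<bullet> b \<le> x \<bullet> y)"
proof -
  have "C \<noteq> {}" using interior_point by auto
  then have "compact (C \<times> C)" "C \<times> C \<noteq> {}"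
    using cpt by (auto intro: compact_Times)
  moreover have "continuous_on (C \<times> C) (\<lambda>(k, l). k \<bullet> l)"
    by (auto simp: case_prod_unfold intro!: continuous_intros)
  ultimately have "\<exists>q\<in>C \<times> C. \<forall>p\<in>C \<times> C. (\<lambda>(k, l). k \<bullet> l) q \<le> (\<lambda>(k, l). k \<bullet> l) p"
    by (rule continuous_attains_inf)
  then obtain a b where ab: "a \<in> C" "b \<in> C" and min: "\<forall>x\<in>C. \<forall>y\<in>C. a \<bullet> b \<le> x \<bullet> y"
    by auto
  have "sph_diam C = arccos (a \<bullet> b)"
    unfolding sph_diam_def
  proof (rule cSup_eq_maximum)
    show "arccos (a \<bullet> b) \<in> (\<lambda>(a, b). sph_dist a b) ` (C \<times> C)"
      using ab by (force simp: sph_dist_def)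
    fix d assume "d \<in> (\<lambda>(a, b). sph_dist a b) ` (C \<times> C)"
    then obtain x y where xy: "x \<in> C" "y \<in> C" "d = arccos (x \<bullet> y)"
      by (auto simp: sph_dist_def)
    then show "d \<le> arccos (a \<bullet> b)"
      using min inner_unit_bounds[OF norm_1[OF ab(1)] norm_1[OF ab(2)]]
        inner_unit_bounds[OF norm_1[OF xy(1)] norm_1[OF xy(2)]]
      by (auto intro!: arccos_le_arccos)
  qed
  with ab min show ?thesis by blast
qed

text \<open>An interior point of the cut is obtained from an interior point \<open>i\<close> of \<open>C\<close> by moving far
  enough towards \<open>x\<close>.\<close>

lemma cut_body:
  assumes "x \<in> C" "0 < x \<bullet> y"
  shows "sph_convex_body {x \<in> C. 0 \<le> x \<bullet> y}"
proof -
  let ?Z = "{x \<in> C. 0 \<le> x \<bullet> y}"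
  have "sph_convex ?Z"
    unfolding sph_convex_def
  proof (intro conjI ballI)
    show "?Z \<subseteq> S2" using sph_convexD(1)[OF conv] by blast
    show "- a \<notin> ?Z" if "a \<in> ?Z" for a using that sph_convexD(3)[OF conv] by blast
    show "sph_arc a b \<subseteq> ?Z" if ab: "a \<in> ?Z" "b \<in> ?Z" for a b
    proof
      fix z assume z: "z \<in> sph_arc a b"
      then have "z \<in> C" using sph_convexD(4)[OF conv] ab by blast
      moreover have "0 \<le> z \<bullet> y" using z ab by (auto simp: sph_arc_def inner_add_left)
      ultimately show "z \<in> ?Z" by blast
    qed
  qed
  moreover have "closedin (top_of_set S2) ?Z"
  proof -
    have "closed {x. 0 \<le> x \<bullet> y}"
      by (intro closed_Collect_le continuous_intros)
    then have "closedin (top_of_set S2) (S2 \<inter> {x. 0 \<le> x \<bullet> y})" by (rule closedin_closed_Int)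
    moreover have "?Z = C \<inter> (S2 \<inter> {x. 0 \<le> x \<bullet> y})" using sph_convexD(1)[OF conv] by blast
    moreover have "closedin (top_of_set S2) C" using convex_body by (simp add: sph_convex_body_def)
    ultimately show ?thesis
      by (simp only: closedin_Int)
  qed
  moreover have "sph_interior ?Z \<noteq> {}"
  proof -
    obtain i where i: "i \<in> C" "\<forall>k\<in>polar C. 0 < k \<bullet> i" using interior_point by blast
    (* large enough for i + N x to be strictly on the side of y *)
    define N where "N = \<bar>i \<bullet> y\<bar> / (x \<bullet> y) + 1"
    have N: "0 < N" "0 < i \<bullet> y + N * (x \<bullet> y)"
    proof -
      show "0 < N" using assms(2) by (simp add: N_def add_nonneg_pos)
      have "N * (x \<bullet> y) = \<bar>i \<bullet> y\<bar> + x \<bullet> y" using assms(2) by (simp add: N_def distrib_right)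
      then show "0 < i \<bullet> y + N * (x \<bullet> y)" using assms(2) by linarith
    qed
    let ?v = "1 *\<^sub>R i + N *\<^sub>R x"
    have v: "?v \<noteq> 0" "sgn ?v \<in> C"
      using conic_combination[OF conv i(1) assms(1), of 1 N] N by auto
    have "sgn ?v \<in> sph_interior C"
    proof (rule interior_if_polar_pos)
      show "norm (sgn ?v) = 1" using v by (simp add: norm_sgn)
      fix k assume k: "k \<in> polar C"
      then have "0 < k \<bullet> i" "0 \<le> k \<bullet> x" using i(2) polarD[OF k assms(1)] by auto
      then have "0 < k \<bullet> ?v" using N by (simp add: inner_add_right add_pos_nonneg)
      then show "0 < k \<bullet> sgn ?v" using v by (simp add: inner_sgn)
    qed
    then obtain T where T: "openin (top_of_set S2) T" "sgn ?v \<in> T" "T \<subseteq> C"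
      by (auto simp: sph_interior_def interior_of_def)
    have "open {x. 0 < x \<bullet> y}" by (intro open_Collect_less continuous_intros)
    then have "openin (top_of_set S2) (T \<inter> {x. 0 < x \<bullet> y})"
      using T(1) by (simp add: openin_Int_open)
    moreover have "0 < ?v \<bullet> y" using N by (simp add: inner_add_left)
    then have "sgn ?v \<in> T \<inter> {x. 0 < x \<bullet> y}" using T v by (simp add: inner_sgn)
    moreover have "T \<inter> {x. 0 < x \<bullet> y} \<subseteq> ?Z" using T by auto
    ultimately have "sgn ?v \<in> sph_interior ?Z"
      unfolding sph_interior_def interior_of_def by blast
    then show ?thesis by blast
  qed
  ultimately show ?thesis by (simp add: sph_convex_body_def)
qed

end

lemma hull_inner_ge:
  fixes A :: "(real^3) set"
  assumes "\<And>a b. a \<in> A \<Longrightarrow> b \<in> A \<Longrightarrow> g \<le> a \<bullet> b"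
    and "a \<in> convex hull A" "b \<in> convex hull A"
  shows "g \<le> a \<bullet> b"
proof -
  have 1: "g \<le> c \<bullet> x" if "\<And>x. x \<in> A \<Longrightarrow> g \<le> c \<bullet> x" "x \<in> convex hull A" for c x :: "real^3"
  proof -
    have "convex hull A \<subseteq> {x. g \<le> c \<bullet> x}"
      using that(1) convex_halfspace_ge[where a = c and b = g] by (intro hull_minimal) auto
    with that(2) show ?thesis by blast
  qed
  have "g \<le> b \<bullet> c" if "c \<in> A" for c
    using 1[of c b] assms(1)[OF that] assms(3) by (simp add: inner_commute)
  from 1[of b a, OF this assms(2)] show ?thesis by (simp add: inner_commute)
qed

locale reduced_body = body R for R +
  assumes reduced: "sph_reduced R"
begin

lemma thickness_cut:
  assumes "x \<in> R" "0 < x \<bullet> y" "z \<in> R" "z \<bullet> y < 0"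
  shows "thickness {x \<in> R. 0 \<le> x \<bullet> y} < thickness R"
proof -
  have "{x \<in> R. 0 \<le> x \<bullet> y} \<noteq> R" using assms(3,4) by force
  then show ?thesis
    using reduced cut_body[OF assms(1,2)] unfolding sph_reduced_def by blast
qed

section \<open>Thickness at least a right angle\<close>

text \<open>Otherwise cut \<open>R\<close> by the hemisphere of \<open>y\<close>. The polar of the cut is the hull of \<open>y\<close> and the
  old polar. Since \<open>- cos \<Delta>\<close> is non-negative, the lower bound for inner products passes from this
  set to its convex hull and from there to the sphere, where vectors only get longer. So the cut is
  as thick as \<open>R\<close>, contrary to reducedness.\<close>

lemma polar_complete:
  assumes thick: "pi / 2 \<le> thickness R" and y: "norm y = 1" "\<forall>z\<in>polar R. - cos (thickness R) \<le> y \<bullet> z"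
  shows "y \<in> polar R"
proof (rule ccontr)
  assume "y \<notin> polar R"
  then obtain z where z: "z \<in> R" "z \<bullet> y < 0" using y(1) by (force simp: polar_def inner_commute)
  define g where "g = - cos (thickness R)"
  have "cos (thickness R) \<le> cos (pi / 2)"
    by (rule cos_monotone_0_pi_le) (use thick thickness_bounds in auto)
  then have g0: "0 \<le> g" by (simp add: g_def)
  have "\<exists>x\<in>R. 0 < x \<bullet> y"
  proof (rule ccontr)
    assume "\<not> ?thesis"
    then have "- y \<in> polar R" using y(1) by (force simp: polar_def inner_commute not_less)
    from bspec[OF y(2) this] have "g \<le> y \<bullet> (- y)" by (simp only: g_def)
    with g0 inner_unit_self[OF y(1)] show False by simp
  qed
  then obtain x where x: "x \<in> R" "0 < x \<bullet> y" by blast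
  let ?Z = "{x \<in> R. 0 \<le> x \<bullet> y}"
  interpret Z: body ?Z by unfold_locales (rule cut_body[OF x])
  have tZ: "thickness ?Z < thickness R" by (rule thickness_cut[OF x z])
  let ?A = "insert y (polar R)"
  have A: "?A \<subseteq> polar ?Z" using y(1) by (auto simp: polar_def inner_commute)
  have A_ge: "g \<le> a \<bullet> b" if "a \<in> ?A" "b \<in> ?A" for a b
  proof -
    have "g \<le> 1" by (simp add: g_def)
    then show ?thesis
      using that y(2) inner_unit_self[OF y(1)] polar_inner_ge by (auto simp: g_def inner_commute)
  qed
  obtain i where i: "\<forall>k\<in>polar ?Z. 0 < k \<bullet> i" using Z.interior_point by blast
  have hull0: "convex hull ?A \<subseteq> {f. 0 < i \<bullet> f}"
    using i A by (intro hull_minimal convex_halfspace_gt) (auto simp: inner_commute)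
  have hull1: "convex hull ?A \<subseteq> cball 0 1"
    using y(1) polar_norm by (intro hull_minimal convex_cball) auto
  (* every point of the polar of the cut projects centrally from the hull; otherwise the separating
     vector would be a point of the cut with negative product *)
  have on_hull: "\<exists>t. 0 < t \<and> t \<le> 1 \<and> t *\<^sub>R k \<in> convex hull ?A" if k: "k \<in> polar ?Z" for k
  proof -
    have "\<exists>t\<ge>0. t *\<^sub>R k \<in> convex hull ?A"
    proof (rule ccontr)
      assume "\<not> ?thesis"
      then have "\<exists>a. a \<bullet> k < 0 \<and> (\<forall>e\<in>?A. 0 < a \<bullet> e)"
        using y(1) polar_norm polar_norm[OF k] compact_polar
        by (intro separate_ray_from_hull) auto
      then obtain a where a: "a \<bullet> k < 0" "\<forall>e\<in>?A. 0 < a \<bullet> e" by blast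
      then have a0: "a \<noteq> 0" by auto
      have "sgn a \<in> R"
        by (rule bipolar[OF conv cpt]) (use a a0 in \<open>auto simp: norm_sgn inner_sgn inner_commute intro!: divide_nonneg_nonneg less_imp_le\<close>)
      then have "sgn a \<in> ?Z" using a a0 by (auto simp: inner_sgn)
      from polarD'[OF k this] a a0 show False by (simp add: inner_sgn field_simps)
    qed
    then obtain t where t: "0 \<le> t" "t *\<^sub>R k \<in> convex hull ?A" by blast
    have "t \<noteq> 0" using t(2) hull0 by auto
    moreover have "t \<le> 1" using hull1 t polar_norm[OF k] by auto
    ultimately show ?thesis using t by (intro exI[of _ t]) simp
  qed
  obtain k l where kl: "k \<in> polar ?Z" "l \<in> polar ?Z" "k \<bullet> l = - cos (thickness ?Z)"
    using Z.polar_inner_attained by blast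
  have "cos (thickness R) < cos (thickness ?Z)"
    by (rule cos_monotone_0_pi) (use tZ thickness_bounds Z.thickness_bounds in auto)
  then have lt: "k \<bullet> l < g" using kl(3) by (simp add: g_def)
  obtain t s where t: "0 < t" "t \<le> 1" "t *\<^sub>R k \<in> convex hull ?A"
    and s: "0 < s" "s \<le> 1" "s *\<^sub>R l \<in> convex hull ?A"
    using on_hull[OF kl(1)] on_hull[OF kl(2)] by blast
  have "g \<le> (t *\<^sub>R k) \<bullet> (s *\<^sub>R l)"
    by (rule hull_inner_ge[OF A_ge t(3) s(3)])
  then have ge: "g \<le> (t * s) * (k \<bullet> l)" by (simp add: mult_ac)
  have ts: "0 < t * s" "t * s \<le> 1" using t s by (auto simp: mult_le_one)
  have "0 \<le> (t * s) * (k \<bullet> l)" using ge g0 by linarith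
  then have "0 \<le> k \<bullet> l" using ts by (simp add: zero_le_mult_iff)
  then have "(t * s) * (k \<bullet> l) \<le> 1 * (k \<bullet> l)" using ts by (intro mult_right_mono) auto
  with ge lt show False by simp
qed

text \<open>Leave the polar from \<open>p\<close>, almost in the direction \<open>- t\<close> and slightly across the boundary of
  the hemisphere of \<open>r\<close>. By completeness some \<open>z\<close> in the polar is too far from the points outside,
  and in the limit \<open>z\<close> is at the maximal distance from \<open>p\<close>, on the side of \<open>t\<close>.\<close>

lemma polar_touches_wide:
  assumes thick: "pi / 2 \<le> thickness R" and p: "p \<in> polar R" and rR: "r \<in> R" and pr: "p \<bullet> r = 0"
    and t: "norm t = 1" "p \<bullet> t = 0" "r \<bullet> t = 0"
  shows "\<exists>z\<in>polar R. z \<bullet> p = - cos (thickness R) \<and> 0 \<le> z \<bullet> t"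
proof -
  define g where "g = - cos (thickness R)"
  have "cos (thickness R) \<le> cos (pi / 2)"
    by (rule cos_monotone_0_pi_le) (use thick thickness_bounds in auto)
  then have g0: "0 \<le> g" "g \<le> 1" by (auto simp: g_def)
  have n: "norm p = 1" "norm r = 1" using polar_norm[OF p] norm_1[OF rR] by auto
  note u = inner_unit_self[OF n(1)] inner_unit_self[OF n(2)] inner_unit_self[OF t(1)]
  (* f measures the failure of both claims; it is non-negative on the polar, so by compactness it is
     enough to make it arbitrarily small *)
  let ?f = "\<lambda>z. (z \<bullet> p - g) + max 0 (- (z \<bullet> t))"
  have small: "\<exists>z\<in>polar R. ?f z \<le> 5 * e" if e: "0 < e" "e \<le> 1" for e
  proof -
    (* the component along r is of second order, so that the direction tends to - t while the point
       stays outside the polar *)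
    define w where "w = p - e *\<^sub>R t - e\<^sup>2 *\<^sub>R r"
    have wr: "w \<bullet> r = - e\<^sup>2"
      using pr t u by (simp add: w_def inner_diff_left inner_commute[of t r])
    have "w \<bullet> w = 1 + e\<^sup>2 + e\<^sup>2 * e\<^sup>2"
      using pr t u by (simp add: w_def inner_diff_left inner_diff_right inner_commute[of t r]
          inner_commute[of t p] inner_commute[of r p] power2_eq_square)
    also have "\<dots> \<le> (1 + e\<^sup>2)\<^sup>2" by (simp add: power2_eq_square algebra_simps)
    finally have "(norm w)\<^sup>2 \<le> (1 + e\<^sup>2)\<^sup>2" by (simp add: power2_norm_eq_inner)
    then have nw: "norm w \<le> 1 + e\<^sup>2" by (rule power2_le_imp_le) simp
    have w0: "w \<noteq> 0" using wr e by auto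
    have "sgn w \<notin> polar R"
      using polarD[of "sgn w" R r] rR wr w0 e by (auto simp: inner_sgn field_simps)
    then obtain z where z: "z \<in> polar R" "sgn w \<bullet> z < g"
      using polar_complete[OF thick, of "sgn w"] w0 by (force simp: norm_sgn g_def not_le)
    then have "w \<bullet> z < g * norm w" using w0 by (simp add: inner_sgn field_simps)
    also have "g * norm w \<le> g * (1 + e\<^sup>2)" using nw g0 by (intro mult_left_mono) auto
    also have "\<dots> \<le> g + e\<^sup>2" using mult_right_mono[OF g0(2), of "e\<^sup>2"] by (simp add: algebra_simps)
    finally have wz: "z \<bullet> p - e * (z \<bullet> t) - e\<^sup>2 * (z \<bullet> r) < g + e\<^sup>2"
      by (simp add: w_def inner_diff_left inner_commute[of z])
    have zb: "z \<bullet> r \<le> 1" "z \<bullet> t \<le> 1" "g \<le> z \<bullet> p"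
      using inner_unit_bounds[OF polar_norm[OF z(1)] n(2)] inner_unit_bounds[OF polar_norm[OF z(1)] t(1)]
        polar_inner_ge[OF z(1) p] by (auto simp: g_def)
    have "e\<^sup>2 * (z \<bullet> r) \<le> e\<^sup>2" using zb by (simp add: mult_left_le)
    with wz have main: "z \<bullet> p - e * (z \<bullet> t) < g + 2 * e\<^sup>2" by linarith
    have ee: "e\<^sup>2 \<le> e" using e by (simp add: power2_eq_square)
    have "e * (z \<bullet> t) \<le> e" using zb e by simp
    with main ee have "z \<bullet> p - g \<le> 3 * e" by linarith
    moreover have "e * (- (z \<bullet> t)) \<le> e * (2 * e)"
      using main zb by (simp add: power2_eq_square)
    then have "- (z \<bullet> t) \<le> 2 * e" using e by (subst (asm) mult_le_cancel_left_pos) auto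
    ultimately have "?f z \<le> 5 * e" using e by auto
    with z show ?thesis by blast
  qed
  have "continuous_on (polar R) ?f" by (intro continuous_intros)
  from continuous_attains_inf[OF compact_polar polar_nonempty this]
  obtain z where z: "z \<in> polar R" "\<forall>y\<in>polar R. ?f z \<le> ?f y" by blast
  have "?f z \<le> 0"
  proof (rule ccontr)
    assume pos: "\<not> ?f z \<le> 0"
    define e where "e = min 1 (?f z / 10)"
    have "0 < e" "e \<le> 1" using pos by (auto simp: e_def)
    from small[OF this] obtain y where "y \<in> polar R" "?f y \<le> 5 * e" by blast
    with z(2) have "?f z \<le> 5 * e" by force
    moreover have "e \<le> ?f z / 10" unfolding e_def by (rule min.cobounded2)
    moreover have "F \<le> 0" if "F \<le> 5 * e" "e \<le> F / 10" for F using that by linarith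
    ultimately show False using pos by blast
  qed
  moreover have "g \<le> z \<bullet> p" using polar_inner_ge[OF z(1) p] by (simp add: g_def)
  ultimately have "z \<bullet> p = g" "0 \<le> z \<bullet> t" by (auto simp: max_def split: if_splits)
  with z show ?thesis by (auto simp: g_def)
qed

text \<open>Call the point \<open>q\<close>. It lies on the circle of radius \<open>\<pi> - \<Delta>\<close> around \<open>p\<close>, between two points of
  the polar on that circle that the previous lemma yields for \<open>t\<close> and \<open>- t\<close>. A point \<open>y\<close> of the
  polar is at least as close to \<open>q\<close> as to the one of the two on the side opposite to \<open>y\<close>. So \<open>q\<close> is
  within \<open>\<pi> - \<Delta>\<close> of the polar, and completeness applies.\<close>

lemma polar_opposite_wide:
  assumes thick: "pi / 2 \<le> thickness R" and p: "p \<in> polar R" and rR: "r \<in> R" and pr: "p \<bullet> r = 0"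
  shows "- cos (thickness R) *\<^sub>R p + sin (thickness R) *\<^sub>R r \<in> polar R"
proof -
  define g where "g = - cos (thickness R)"
  define S where "S = sin (thickness R)"
  have S0: "0 \<le> S" unfolding S_def using thickness_bounds by (simp add: sin_ge_zero)
  have gS: "g\<^sup>2 + S\<^sup>2 = 1" by (simp add: g_def S_def)
  have n: "norm p = 1" "norm r = 1" using polar_norm[OF p] norm_1[OF rR] by auto
  note u = inner_unit_self[OF n(1)] inner_unit_self[OF n(2)]
  obtain t where t: "norm t = 1" "t \<bullet> p = 0" "t \<bullet> r = 0" by (rule obtain_orthogonal_unit)
  let ?q = "g *\<^sub>R p + S *\<^sub>R r"
  have "?q \<bullet> ?q = 1"
    using pr u gS by (simp add: inner_add_left inner_add_right inner_commute[of r p] power2_eq_square)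
  then have q1: "norm ?q = 1" by (simp add: norm_eq_1)
  have side: "g \<le> y \<bullet> ?q" if y: "y \<in> polar R" and t: "norm t = 1" "p \<bullet> t = 0" "r \<bullet> t = 0" "y \<bullet> t \<le> 0" for y t
  proof -
    obtain z where z: "z \<in> polar R" "z \<bullet> p = g" "0 \<le> z \<bullet> t"
      using polar_touches_wide[OF thick p rR pr t(1-3)] by (auto simp: g_def)
    note ex = orthonormal_inner[OF n(1,2) t(1) pr t(2,3)]
    have "1 = g\<^sup>2 + (z \<bullet> r)\<^sup>2 + (z \<bullet> t)\<^sup>2"
      using ex[of z z] z inner_unit_self[OF polar_norm[OF z(1)]] by (simp add: power2_eq_square)
    then have "(z \<bullet> r)\<^sup>2 \<le> S\<^sup>2" using gS by simp (smt (verit) zero_le_power2)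
    then have zr: "z \<bullet> r \<le> S" using S0 by (rule power2_le_imp_le)
    have "g \<le> y \<bullet> z" using polar_inner_ge[OF y z(1)] by (simp add: g_def)
    also have "y \<bullet> z = (y \<bullet> p) * g + (y \<bullet> r) * (z \<bullet> r) + (y \<bullet> t) * (z \<bullet> t)"
      using ex[of y z] z by simp
    also have "\<dots> \<le> (y \<bullet> p) * g + (y \<bullet> r) * S + 0"
      using polarD[OF y rR] zr z t(4) by (intro add_mono mult_left_mono mult_nonpos_nonneg order_refl) auto
    also have "\<dots> = y \<bullet> ?q" by (simp add: inner_add_right mult.commute)
    finally show ?thesis .
  qed
  have "?q \<in> polar R"
  proof (rule polar_complete[OF thick q1], intro ballI)
    fix y assume y: "y \<in> polar R"
    have "g \<le> y \<bullet> ?q"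
    proof (cases "y \<bullet> t \<le> 0")
      case True
      then show ?thesis using side[OF y t(1)] t by (simp add: inner_commute)
    next
      case False
      then show ?thesis using side[OF y, of "- t"] t by (simp add: inner_commute)
    qed
    then show "- cos (thickness R) \<le> ?q \<bullet> y" by (simp add: g_def inner_commute)
  qed
  then show ?thesis by (simp add: g_def S_def)
qed

text \<open>Let \<open>a\<close> be farthest from \<open>b\<close>. The component \<open>f\<close> of \<open>b\<close> orthogonal to \<open>a\<close> gives a point \<open>p\<close> of
  the polar with \<open>p \<bullet> a = 0\<close>, and the opposite point \<open>q\<close> from the previous lemma must satisfy
  \<open>0 \<le> b \<bullet> q\<close>. All these points are in the plane of \<open>a\<close> and \<open>b\<close>, where the inequality says that the
  angle of \<open>a\<close> and \<open>b\<close> is at most \<open>\<Delta>\<close>.\<close>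

lemma inner_ge_wide:
  assumes thick: "pi / 2 \<le> thickness R" and ab: "a \<in> R" "b \<in> R" and min: "\<forall>y\<in>R. b \<bullet> a \<le> b \<bullet> y"
  shows "cos (thickness R) \<le> b \<bullet> a"
proof (rule ccontr)
  assume less: "\<not> cos (thickness R) \<le> b \<bullet> a"
  define g where "g = - cos (thickness R)"
  define S where "S = sin (thickness R)"
  define c where "c = b \<bullet> a"
  have S0: "0 < S" unfolding S_def using thickness_bounds by (simp add: sin_gt_zero)
  have gS: "g\<^sup>2 + S\<^sup>2 = 1" by (simp add: g_def S_def)
  have "cos (thickness R) \<le> cos (pi / 2)"
    by (rule cos_monotone_0_pi_le) (use thick thickness_bounds in auto)
  then have g0: "0 \<le> g" by (simp add: g_def)
  have cg: "g < - c" using less by (simp add: g_def c_def)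
  have n: "norm a = 1" "norm b = 1" using norm_1 ab by auto
  note u = inner_unit_self[OF n(1)] inner_unit_self[OF n(2)]
  have "c \<noteq> -1"
    using inner_unit_eq_minus_1[OF n(2,1)] sph_convexD(3)[OF conv ab(1)] ab(2) by (auto simp: c_def)
  then have c: "- 1 < c" "c < 0" using inner_unit_bounds[OF n(2,1)] cg g0 by (auto simp: c_def)
  define f where "f = b - c *\<^sub>R a"
  have fa: "f \<bullet> a = 0" by (simp add: f_def inner_diff_left u c_def)
  have fb: "b \<bullet> f = 1 - c\<^sup>2" by (simp add: f_def inner_diff_right u power2_eq_square flip: c_def)
  have nf: "norm f = sqrt (1 - c\<^sup>2)"
    by (simp add: f_def norm_eq_sqrt_inner inner_diff_left inner_diff_right u inner_commute[of a b]
        power2_eq_square flip: c_def)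
  have c2: "c\<^sup>2 < 1" using c by (simp add: abs_square_less_1)
  have f0: "f \<noteq> 0" using nf c2 by auto
  have "sgn f \<in> polar R"
  proof -
    have "0 \<le> f \<bullet> y" if "y \<in> R" for y
      using minimal_inner_variation[OF conv ab(1) min that] by (simp add: f_def inner_diff_left c_def)
    then show ?thesis using f0 by (simp add: polar_def norm_sgn inner_sgn)
  qed
  moreover have "sgn f \<bullet> a = 0" using fa by (simp add: inner_sgn)
  ultimately have "g *\<^sub>R sgn f + S *\<^sub>R a \<in> polar R"
    using polar_opposite_wide[OF thick _ ab(1)] by (simp add: g_def S_def)
  from polarD'[OF this ab(2)] have "0 \<le> g * (b \<bullet> sgn f) + S * c"
    by (simp add: inner_add_right c_def)
  moreover have "b \<bullet> sgn f = sqrt (1 - c\<^sup>2)"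
    using nf fb c2 by (simp add: inner_sgn real_div_sqrt)
  moreover have "sqrt (1 - c\<^sup>2) \<le> S"
  proof (rule real_le_lsqrt)
    have "g\<^sup>2 \<le> (- c)\<^sup>2" using cg g0 by (intro power_mono) auto
    then show "1 - c\<^sup>2 \<le> S\<^sup>2" using gS by simp
  qed (use S0 c2 in auto)
  then have "g * sqrt (1 - c\<^sup>2) \<le> g * S" using g0 by (rule mult_left_mono)
  moreover have "S * g < S * (- c)" using cg S0 by (rule mult_strict_left_mono)
  ultimately show False by (simp add: mult.commute)
qed

text \<open>The two centers of a thinnest lune are in \<open>R\<close> and have distance \<open>\<Delta>\<close>.\<close>

lemma inner_attained:
  "\<exists>a\<in>R. \<exists>b\<in>R. a \<bullet> b = cos (thickness R)"
proof -
  obtain k l where kl: "k \<in> polar R" "l \<in> polar R" "k \<bullet> l = - cos (thickness R)"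
    and min: "\<forall>k'\<in>polar R. \<forall>l'\<in>polar R. k \<bullet> l \<le> k' \<bullet> l'"
    using polar_inner_attained by blast
  define c where "c = k \<bullet> l"
  have mink: "\<forall>y\<in>polar R. k \<bullet> l \<le> k \<bullet> y" and minl: "\<forall>y\<in>polar R. l \<bullet> k \<le> l \<bullet> y"
    using min kl by (auto simp: inner_commute[of l])
  note f = farthest_in_polar[OF kl(1,2) mink] and e = farthest_in_polar[OF kl(2,1) minl]
  have u: "k \<bullet> k = 1" "l \<bullet> l = 1" using kl polar_norm inner_unit_self by auto
  have c2: "c\<^sup>2 < 1" using f(1,2) by (simp add: abs_square_less_1 c_def abs_less_iff)
  have "(k - c *\<^sub>R l) \<bullet> (l - c *\<^sub>R k) = - c * (1 - c\<^sup>2)"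
    by (simp add: inner_diff_left inner_diff_right u inner_commute[of l k] power2_eq_square algebra_simps flip: c_def)
  then have "sgn (k - c *\<^sub>R l) \<bullet> sgn (l - c *\<^sub>R k) = - c"
    using f(5) e(5) c2 by (simp add: inner_sgn inner_commute[of l k] flip: c_def)
  with f(3) e(3) kl(3) show ?thesis by (force simp: c_def inner_commute[of l k])
qed

lemma sph_diam_wide:
  assumes "pi / 2 \<le> thickness R"
  shows "sph_diam R = thickness R"
proof -
  obtain a b where ab: "b \<in> R" "a \<in> R" "sph_diam R = arccos (b \<bullet> a)" "\<forall>x\<in>R. \<forall>y\<in>R. b \<bullet> a \<le> x \<bullet> y"
    using sph_diam_attained by blast
  then have "cos (thickness R) \<le> b \<bullet> a" by (intro inner_ge_wide assms) auto
  moreover have "b \<bullet> a \<le> cos (thickness R)" using ab(4) inner_attained by metis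
  ultimately have eq: "b \<bullet> a = cos (thickness R)" by simp
  show ?thesis unfolding ab(3) eq using thickness_bounds by (simp add: arccos_cos)
qed

end

section \<open>Planar cones and their projections\<close>

lemma combination_norm:
  fixes e f :: "real^3"
  assumes "norm e = 1" "norm f = 1"
  shows "(norm (a *\<^sub>R e + b *\<^sub>R f))\<^sup>2 = a\<^sup>2 + b\<^sup>2 + 2 * a * b * (e \<bullet> f)"
  using inner_unit_self[OF assms(1)] inner_unit_self[OF assms(2)]
  by (simp add: power2_norm_eq_inner inner_add_left inner_add_right inner_commute[of f e])
    (simp add: power2_eq_square algebra_simps)

lemma combination_eq_0:
  fixes e f :: "real^3"
  assumes "norm e = 1" "norm f = 1" "\<bar>e \<bullet> f\<bar> < 1" "a *\<^sub>R e + b *\<^sub>R f = 0"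
  shows "a = 0" "b = 0"
proof -
  define c where "c = e \<bullet> f"
  have "a\<^sup>2 + b\<^sup>2 + 2 * a * b * c = 0"
    using combination_norm[OF assms(1,2), of a b] assms(4) by (simp add: c_def)
  then have sum: "(a + c * b)\<^sup>2 + (1 - c\<^sup>2) * b\<^sup>2 = 0"
    by (simp add: power2_eq_square algebra_simps)
  have c: "0 < 1 - c\<^sup>2" using assms(3) by (simp add: c_def abs_square_less_1)
  have "0 \<le> (a + c * b)\<^sup>2" "0 \<le> (1 - c\<^sup>2) * b\<^sup>2" using c by auto
  with sum have "(a + c * b)\<^sup>2 = 0" "(1 - c\<^sup>2) * b\<^sup>2 = 0" by linarith+
  with c show "a = 0" "b = 0" by auto
qed

text \<open>The vector \<open>v\<close> is in the sector between \<open>e\<close> and \<open>f\<close>, so its angle with \<open>e\<close> is at most that of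
  \<open>f\<close> with \<open>e\<close>, with equality only on the ray of \<open>f\<close>.\<close>

lemma cone_end_inner:
  fixes e f :: "real^3"
  assumes "norm e = 1" "norm f = 1" "e \<bullet> f = c" "0 < c" "c < 1" "0 \<le> a" "0 \<le> b"
    and v: "v = a *\<^sub>R e + b *\<^sub>R f"
  shows "c * norm v \<le> v \<bullet> e" "v \<bullet> e = c * norm v \<Longrightarrow> a = 0"
proof -
  have ve: "v \<bullet> e = a + b * c"
    using assms(3) inner_unit_self[OF assms(1)] by (simp add: v inner_add_left inner_commute[of f e])
  have diff: "(v \<bullet> e)\<^sup>2 - (c * norm v)\<^sup>2 = (1 - c\<^sup>2) * (a\<^sup>2 + 2 * a * b * c)"
    unfolding power_mult_distrib v combination_norm[OF assms(1,2)] unfolding v[symmetric] ve assms(3)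
    by (simp add: power2_eq_square algebra_simps)
  have c2: "0 < 1 - c\<^sup>2" using assms(4,5) by (simp add: abs_square_less_1)
  have "0 \<le> (1 - c\<^sup>2) * (a\<^sup>2 + 2 * a * b * c)" using c2 assms(4-7) by (intro mult_nonneg_nonneg add_nonneg_nonneg) auto
  with diff have "(c * norm v)\<^sup>2 \<le> (v \<bullet> e)\<^sup>2" by linarith
  then show "c * norm v \<le> v \<bullet> e" by (rule power2_le_imp_le) (use ve assms(4-7) in simp)
  assume "v \<bullet> e = c * norm v"
  with diff c2 have "a\<^sup>2 + 2 * a * b * c = 0" by simp
  moreover have "0 \<le> 2 * a * b * c" using assms(4-7) by simp
  ultimately have "a\<^sup>2 \<le> 0" by linarith
  then show "a = 0" by simp
qed

text \<open>The orthogonal projection of \<open>x\<close> to the plane of \<open>e\<close> and \<open>f\<close> lies in the sector spanned by \<open>e\<close>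
  and \<open>f\<close>.\<close>

definition projects_into :: "real^3 \<Rightarrow> real^3 \<Rightarrow> real^3 \<Rightarrow> bool" where
  "projects_into x e f \<longleftrightarrow> (\<exists>a\<ge>0. \<exists>b\<ge>0.
     (x - (a *\<^sub>R e + b *\<^sub>R f)) \<bullet> e = 0 \<and> (x - (a *\<^sub>R e + b *\<^sub>R f)) \<bullet> f = 0)"

text \<open>The projection from the second plane to the first has a non-negative matrix in the bases
  \<open>e2, f2\<close> and \<open>e1, f1\<close>, and it maps the common vector to itself. Hence taking absolute values of
  the coordinates in the second plane and projecting gives at least the absolute values of the
  coordinates in the first. The difference \<open>N\<close> is in the sector of \<open>e1\<close> and \<open>f1\<close>, whose vectors have
  non-negative products, so removing it shortens the vector, as does the projection. If no length is
  lost, neither step changes anything.\<close>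

lemma abs_combination_norm_le:
  fixes e1 f1 e2 f2 :: "real^3"
  assumes n: "norm e1 = 1" "norm f1 = 1" and c: "0 \<le> e1 \<bullet> f1" "e1 \<bullet> f1 < 1"
    and pr: "projects_into e2 e1 f1" "projects_into f2 e1 f1"
    and eq: "p *\<^sub>R e1 + q *\<^sub>R f1 = r *\<^sub>R e2 + s *\<^sub>R f2"
  shows "norm (\<bar>p\<bar> *\<^sub>R e1 + \<bar>q\<bar> *\<^sub>R f1) \<le> norm (\<bar>r\<bar> *\<^sub>R e2 + \<bar>s\<bar> *\<^sub>R f2)"
    "norm (\<bar>r\<bar> *\<^sub>R e2 + \<bar>s\<bar> *\<^sub>R f2) \<le> norm (\<bar>p\<bar> *\<^sub>R e1 + \<bar>q\<bar> *\<^sub>R f1) \<Longrightarrow>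
       \<bar>p\<bar> *\<^sub>R e1 + \<bar>q\<bar> *\<^sub>R f1 = \<bar>r\<bar> *\<^sub>R e2 + \<bar>s\<bar> *\<^sub>R f2"
proof -
  from pr(1) obtain a b where ab: "0 \<le> a" "0 \<le> b"
    and "(e2 - (a *\<^sub>R e1 + b *\<^sub>R f1)) \<bullet> e1 = 0" "(e2 - (a *\<^sub>R e1 + b *\<^sub>R f1)) \<bullet> f1 = 0"
    by (auto simp: projects_into_def)
  define d1 where "d1 = e2 - (a *\<^sub>R e1 + b *\<^sub>R f1)"
  have d1: "d1 \<bullet> e1 = 0" "d1 \<bullet> f1 = 0" unfolding d1_def by fact+
  from pr(2) obtain a' b' where ab': "0 \<le> a'" "0 \<le> b'"
    and "(f2 - (a' *\<^sub>R e1 + b' *\<^sub>R f1)) \<bullet> e1 = 0" "(f2 - (a' *\<^sub>R e1 + b' *\<^sub>R f1)) \<bullet> f1 = 0"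
    by (auto simp: projects_into_def)
  define d2 where "d2 = f2 - (a' *\<^sub>R e1 + b' *\<^sub>R f1)"
  have d2: "d2 \<bullet> e1 = 0" "d2 \<bullet> f1 = 0" unfolding d2_def by fact+
  have e2: "e2 = a *\<^sub>R e1 + b *\<^sub>R f1 + d1" and f2: "f2 = a' *\<^sub>R e1 + b' *\<^sub>R f1 + d2"
    by (simp_all add: d1_def d2_def)
  define X where "X = (p - r * a - s * a') *\<^sub>R e1 + (q - r * b - s * b') *\<^sub>R f1"
  have "X = (p *\<^sub>R e1 + q *\<^sub>R f1) - (r *\<^sub>R e2 + s *\<^sub>R f2) + (r *\<^sub>R d1 + s *\<^sub>R d2)"
    unfolding X_def e2 f2 by (simp add: algebra_simps)
  then have X2: "X = r *\<^sub>R d1 + s *\<^sub>R d2" using eq by simp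
  have "X \<bullet> X = (r *\<^sub>R d1 + s *\<^sub>R d2) \<bullet> ((p - r * a - s * a') *\<^sub>R e1 + (q - r * b - s * b') *\<^sub>R f1)"
    using X2 X_def by simp
  also have "\<dots> = 0" by (simp add: inner_add_left inner_add_right d1 d2)
  finally have "X = 0" by simp
  then have pq: "p = r * a + s * a'" "q = r * b + s * b'"
    using combination_eq_0[OF n, of "p - r * a - s * a'" "q - r * b - s * b'"] c by (simp_all add: X_def)
  define g h where "g = \<bar>r\<bar> * a + \<bar>s\<bar> * a' - \<bar>p\<bar>" and "h = \<bar>r\<bar> * b + \<bar>s\<bar> * b' - \<bar>q\<bar>"
  have "0 \<le> g" "0 \<le> h"
    unfolding g_def h_def pq using abs_triangle_ineq[of "r * a" "s * a'"] abs_triangle_ineq[of "r * b" "s * b'"] ab ab'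
    by (simp_all add: abs_mult)
  let ?w1 = "\<bar>p\<bar> *\<^sub>R e1 + \<bar>q\<bar> *\<^sub>R f1" and ?w2 = "\<bar>r\<bar> *\<^sub>R e2 + \<bar>s\<bar> *\<^sub>R f2"
  define N D where "N = g *\<^sub>R e1 + h *\<^sub>R f1" and "D = \<bar>r\<bar> *\<^sub>R d1 + \<bar>s\<bar> *\<^sub>R d2"
  have w2: "?w2 = ?w1 + N + D"
    unfolding e2 f2 N_def D_def g_def h_def by (simp add: algebra_simps)
  have D0: "D \<bullet> ?w1 = 0" "D \<bullet> N = 0"
    by (simp_all add: N_def D_def inner_add_left inner_add_right d1 d2)
  have wN: "0 \<le> ?w1 \<bullet> N"
    using \<open>0 \<le> g\<close> \<open>0 \<le> h\<close> c(1) inner_unit_self[OF n(1)] inner_unit_self[OF n(2)]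
    by (simp add: N_def inner_add_left inner_add_right inner_commute[of f1 e1])
  have "(norm ?w2)\<^sup>2 = (norm ?w1)\<^sup>2 + (norm N)\<^sup>2 + (norm D)\<^sup>2 + 2 * (?w1 \<bullet> N)"
  proof -
    have "(x + y + D) \<bullet> (x + y + D) = x \<bullet> x + y \<bullet> y + D \<bullet> D + 2 * (x \<bullet> y) + 2 * (D \<bullet> x) + 2 * (D \<bullet> y)"
      for x y :: "real^3" by (simp add: inner_add_left inner_add_right inner_commute)
    from this[of ?w1 N] show ?thesis unfolding w2 power2_norm_eq_inner D0 by simp
  qed
  with wN have le: "(norm ?w1)\<^sup>2 + (norm N)\<^sup>2 + (norm D)\<^sup>2 \<le> (norm ?w2)\<^sup>2" by linarith
  then have "(norm ?w1)\<^sup>2 \<le> (norm ?w2)\<^sup>2" by (smt (verit) zero_le_power2)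
  then show "norm ?w1 \<le> norm ?w2" by (rule power2_le_imp_le) simp
  assume "norm ?w2 \<le> norm ?w1"
  then have "(norm ?w2)\<^sup>2 \<le> (norm ?w1)\<^sup>2" by (rule power_mono) simp
  with le have "(norm N)\<^sup>2 \<le> 0" "(norm D)\<^sup>2 \<le> 0" by (smt (verit) zero_le_power2)+
  then have "N = 0" "D = 0" by simp_all
  with w2 show "?w1 = ?w2" by simp
qed

lemma in_plane:
  fixes e f n x :: "real^3"
  assumes "norm e = 1" "norm f = 1" "\<bar>e \<bullet> f\<bar> < 1" "norm n = 1" "n \<bullet> e = 0" "n \<bullet> f = 0" "x \<bullet> n = 0"
  shows "\<exists>a b. x = a *\<^sub>R e + b *\<^sub>R f"
proof -
  define g where "g = f - (e \<bullet> f) *\<^sub>R e"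
  have "g \<noteq> 0" using combination_eq_0(2)[OF assms(1-3), of "- (e \<bullet> f)" 1] by (auto simp: g_def)
  have "x = (x \<bullet> e) *\<^sub>R e + (x \<bullet> sgn g) *\<^sub>R sgn g + (x \<bullet> n) *\<^sub>R n"
  proof (rule orthonormal_expansion)
    show "e \<bullet> sgn g = 0" using inner_unit_self[OF assms(1)] by (simp add: g_def inner_sgn inner_diff_right)
    show "sgn g \<bullet> n = 0" using assms
      by (simp add: g_def inner_sgn inner_diff_left inner_commute[of e n] inner_commute[of f n])
  qed (use assms \<open>g \<noteq> 0\<close> in \<open>auto simp: norm_sgn inner_commute\<close>)
  also have "\<dots> = (x \<bullet> e) *\<^sub>R e + ((x \<bullet> sgn g) / norm g) *\<^sub>R g"
    using assms(7) by (simp add: sgn_div_norm divide_inverse)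
  also have "\<dots> = (x \<bullet> e - (x \<bullet> sgn g) / norm g * (e \<bullet> f)) *\<^sub>R e + ((x \<bullet> sgn g) / norm g) *\<^sub>R f"
    by (simp add: g_def algebra_simps)
  finally show ?thesis by blast
qed

text \<open>The two planes share a non-zero vector. Replace its coordinates by their absolute values in
  either plane. By the previous lemma, used in both directions, the two vectors \<open>w1\<close> and \<open>w2\<close> have
  equal norms and so coincide; this is the Perron eigenvector of a non-negative matrix. It lies in
  both sectors.\<close>

lemma projecting_arcs_meet:
  fixes e1 f1 e2 f2 :: "real^3"
  assumes n1: "norm e1 = 1" "norm f1 = 1" and c1: "0 \<le> e1 \<bullet> f1" "e1 \<bullet> f1 < 1"
    and n2: "norm e2 = 1" "norm f2 = 1" and c2: "0 \<le> e2 \<bullet> f2" "e2 \<bullet> f2 < 1"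
    and pr1: "projects_into e2 e1 f1" "projects_into f2 e1 f1"
    and pr2: "projects_into e1 e2 f2" "projects_into f1 e2 f2"
  shows "\<exists>z. norm z = 1 \<and> (\<exists>a\<ge>0. \<exists>b\<ge>0. z = a *\<^sub>R e1 + b *\<^sub>R f1) \<and>
      (\<exists>a\<ge>0. \<exists>b\<ge>0. z = a *\<^sub>R e2 + b *\<^sub>R f2)"
proof -
  obtain m1 where m1: "norm m1 = 1" "m1 \<bullet> e1 = 0" "m1 \<bullet> f1 = 0" by (rule obtain_orthogonal_unit)
  obtain m2 where m2: "norm m2 = 1" "m2 \<bullet> e2 = 0" "m2 \<bullet> f2 = 0" by (rule obtain_orthogonal_unit)
  obtain w where w: "norm w = 1" "w \<bullet> m1 = 0" "w \<bullet> m2 = 0" by (rule obtain_orthogonal_unit)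
  have c1': "\<bar>e1 \<bullet> f1\<bar> < 1" and c2': "\<bar>e2 \<bullet> f2\<bar> < 1" using c1 c2 by auto
  obtain p q where pq: "w = p *\<^sub>R e1 + q *\<^sub>R f1"
    using in_plane[OF n1 c1' m1 w(2)] by blast
  obtain r s where rs: "w = r *\<^sub>R e2 + s *\<^sub>R f2"
    using in_plane[OF n2 c2' m2 w(3)] by blast
  let ?w1 = "\<bar>p\<bar> *\<^sub>R e1 + \<bar>q\<bar> *\<^sub>R f1" and ?w2 = "\<bar>r\<bar> *\<^sub>R e2 + \<bar>s\<bar> *\<^sub>R f2"
  have eq: "p *\<^sub>R e1 + q *\<^sub>R f1 = r *\<^sub>R e2 + s *\<^sub>R f2" using pq rs by simp
  have w12: "?w1 = ?w2"
    by (rule abs_combination_norm_le(2)[OF n1 c1 pr1 eq])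
      (rule abs_combination_norm_le(1)[OF n2 c2 pr2 eq[symmetric]])
  have w0: "?w1 \<noteq> 0"
  proof
    assume "?w1 = 0"
    from combination_eq_0[OF n1 c1' this] have "p = 0" "q = 0" by simp_all
    then show False using pq w(1) by simp
  qed
  have s1: "sgn ?w1 = (\<bar>p\<bar> / norm ?w1) *\<^sub>R e1 + (\<bar>q\<bar> / norm ?w1) *\<^sub>R f1"
    by (simp add: sgn_div_norm scaleR_add_right divide_inverse_commute)
  have s2: "sgn ?w1 = (\<bar>r\<bar> / norm ?w1) *\<^sub>R e2 + (\<bar>s\<bar> / norm ?w1) *\<^sub>R f2"
    unfolding w12 by (simp add: sgn_div_norm scaleR_add_right divide_inverse_commute)
  show ?thesis
  proof (intro exI[of _ "sgn ?w1"] conjI)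
    show "norm (sgn ?w1) = 1" using w0 by (simp add: norm_sgn)
    show "\<exists>a\<ge>0. \<exists>b\<ge>0. sgn ?w1 = a *\<^sub>R e1 + b *\<^sub>R f1"
      using s1 by (meson abs_ge_zero divide_nonneg_nonneg norm_ge_zero)
    show "\<exists>a\<ge>0. \<exists>b\<ge>0. sgn ?w1 = a *\<^sub>R e2 + b *\<^sub>R f2"
      using s2 by (meson abs_ge_zero divide_nonneg_nonneg norm_ge_zero)
  qed
qed

text \<open>Let \<open>v\<close> be the projection of \<open>e2\<close> to the first plane and \<open>z\<close> the common point of the arcs.
  Then \<open>c \<le> z \<bullet> e2 = z \<bullet> v \<le> norm v\<close> and \<open>c * norm v \<le> v \<bullet> e1 = e2 \<bullet> e1\<close>. In the case of equality
  all these are equalities, and \<open>z\<close> is the far end of both arcs.\<close>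

lemma projecting_arcs_ends:
  fixes e1 f1 e2 f2 :: "real^3"
  assumes n1: "norm e1 = 1" "norm f1 = 1" and c1: "e1 \<bullet> f1 = c"
    and n2: "norm e2 = 1" "norm f2 = 1" and c2: "e2 \<bullet> f2 = c"
    and c: "0 < c" "c < 1"
    and pr1: "projects_into e2 e1 f1" "projects_into f2 e1 f1"
    and pr2: "projects_into e1 e2 f2" "projects_into f1 e2 f2"
  shows "c\<^sup>2 \<le> e1 \<bullet> e2"
    "e1 \<bullet> e2 = c\<^sup>2 \<Longrightarrow> f1 = f2 \<and> (e2 - c *\<^sub>R f1) \<bullet> e1 = 0"
proof -
  obtain z a b p q where z: "norm z = 1" and ab: "0 \<le> a" "0 \<le> b" "z = a *\<^sub>R e1 + b *\<^sub>R f1"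
    and pq: "0 \<le> p" "0 \<le> q" "z = p *\<^sub>R e2 + q *\<^sub>R f2"
  proof -
    have "0 \<le> e1 \<bullet> f1" "e1 \<bullet> f1 < 1" "0 \<le> e2 \<bullet> f2" "e2 \<bullet> f2 < 1" using c c1 c2 by auto
    from projecting_arcs_meet[OF n1 this(1,2) n2 this(3,4) pr1 pr2] that show thesis
      by (elim exE conjE)
  qed
  from pr1(1) obtain r s where rs: "0 \<le> r" "0 \<le> s"
    and "(e2 - (r *\<^sub>R e1 + s *\<^sub>R f1)) \<bullet> e1 = 0" "(e2 - (r *\<^sub>R e1 + s *\<^sub>R f1)) \<bullet> f1 = 0"
    by (auto simp: projects_into_def)
  define v where "v = r *\<^sub>R e1 + s *\<^sub>R f1"
  have d: "(e2 - v) \<bullet> e1 = 0" "(e2 - v) \<bullet> f1 = 0" unfolding v_def by fact+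
  note v1 = cone_end_inner[OF n1 c1 c rs v_def] and z2 = cone_end_inner[OF n2 c2 c pq]
  have e12: "e1 \<bullet> e2 = v \<bullet> e1" using d(1) by (simp add: inner_diff_left inner_commute[of e1])
  have "(e2 - v) \<bullet> z = 0" using d by (simp add: ab(3) inner_add_right)
  then have ze: "z \<bullet> e2 = z \<bullet> v" by (simp add: inner_diff_left inner_commute[of z e2] inner_commute[of z v])
  have zv: "z \<bullet> v \<le> norm v" using norm_cauchy_schwarz[of z v] z by simp
  have "c * c \<le> c * (z \<bullet> e2)" using z2(1) z c by (intro mult_left_mono) auto
  moreover have "c * (z \<bullet> e2) \<le> c * norm v" using ze zv c by (intro mult_left_mono) auto
  ultimately show "c\<^sup>2 \<le> e1 \<bullet> e2" using v1(1) e12 by (simp add: power2_eq_square)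
  assume eq: "e1 \<bullet> e2 = c\<^sup>2"
  have cc: "c\<^sup>2 = c * c" by (simp add: power2_eq_square)
  have "c * norm v = c * c" "c * (z \<bullet> e2) = c * c"
    using \<open>c * c \<le> c * (z \<bullet> e2)\<close> \<open>c * (z \<bullet> e2) \<le> c * norm v\<close> v1(1) e12 eq cc by linarith+
  then have nv: "norm v = c" and zc: "z \<bullet> e2 = c" using c by auto
  have "r = 0" using v1(2) e12 eq nv cc by simp
  then have "v = s *\<^sub>R f1" by (simp add: v_def)
  moreover from this have "s = c" using nv n1 rs by simp
  ultimately have v: "v = c *\<^sub>R f1" by simp
  have "p = 0" using z2(2) zc z by simp
  then have zq: "z = q *\<^sub>R f2" using pq by simp
  then have "norm z = q" unfolding zq using n2 pq(2) by simp
  then have zf: "z = f2" using z zq by simp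
  have "c * (z \<bullet> f1) = c" using ze zc v by simp
  then have "z = f1" using c inner_unit_eq_1[OF z n1(2)] by simp
  with zf d(1) v show "f1 = f2 \<and> (e2 - c *\<^sub>R f1) \<bullet> e1 = 0" by simp
qed

section \<open>Thin lunes of a reduced body\<close>

context reduced_body
begin

text \<open>The centers of semicircles of the lunes of minimal thickness around \<open>R\<close>. If \<open>e\<close> is the center
  of the semicircle on the boundary of the hemisphere of \<open>k\<close> and the lune has thickness \<open>\<Delta>\<close>, then
  the second hemisphere has the center \<open>sin \<Delta> e - cos \<Delta> k\<close>.\<close>

definition thin_points :: "(real^3) set" where
  "thin_points = {e \<in> R. \<exists>k\<in>polar R. k \<bullet> e = 0 \<and>
     sin (thickness R) *\<^sub>R e - cos (thickness R) *\<^sub>R k \<in> polar R}"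

lemma sin_thickness: "0 < sin (thickness R)"
  using thickness_bounds by (simp add: sin_gt_zero)

text \<open>The hemisphere of \<open>k\<close> contains the cut, but not all of \<open>R\<close>. If it touched the cut at a point
  \<open>e\<close> off the cutting circle, the cut and \<open>R\<close> would agree near \<open>e\<close>, and moving from \<open>e\<close> towards a
  point \<open>x\<close> of \<open>R\<close> outside the hemisphere would lead out of the hemisphere within the cut.\<close>

lemma polar_meets_cut:
  assumes cut: "sph_convex_body {x \<in> R. 0 \<le> x \<bullet> y}"
    and k: "k \<in> polar {x \<in> R. 0 \<le> x \<bullet> y}" "k \<notin> polar R"
    and e: "e \<in> R" "0 \<le> e \<bullet> y" "k \<bullet> e = 0"
  shows "e \<bullet> y = 0"
proof (rule ccontr)
  assume "e \<bullet> y \<noteq> 0"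
  with e have pos: "0 < e \<bullet> y" by simp
  obtain x where x: "x \<in> R" "k \<bullet> x < 0"
    using k polar_norm[OF k(1)] by (force simp: polar_def)
  (* small enough for e + d x to remain on the side of y *)
  define d where "d = e \<bullet> y / (\<bar>x \<bullet> y\<bar> + 1)"
  have d: "0 < d" using pos by (simp add: d_def)
  have "d * \<bar>x \<bullet> y\<bar> \<le> d * (\<bar>x \<bullet> y\<bar> + 1)" using d by simp
  also have "\<dots> = e \<bullet> y" by (simp add: d_def field_simps add_pos_nonneg)
  finally have dxy: "d * \<bar>x \<bullet> y\<bar> \<le> e \<bullet> y" .
  moreover have "- (d * \<bar>x \<bullet> y\<bar>) \<le> d * (x \<bullet> y)"
    using d abs_ge_minus_self[of "x \<bullet> y"] mult_left_mono[of "- (x \<bullet> y)" "\<bar>x \<bullet> y\<bar>" d] by simp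
  ultimately have ge: "0 \<le> e \<bullet> y + d * (x \<bullet> y)" by linarith
  let ?v = "1 *\<^sub>R e + d *\<^sub>R x"
  have v: "?v \<noteq> 0" "sgn ?v \<in> R"
    using conic_combination[OF conv e(1) x(1), of 1 d] d by auto
  have "0 \<le> ?v \<bullet> y" using ge by (simp add: inner_add_left)
  then have "sgn ?v \<in> {x \<in> R. 0 \<le> x \<bullet> y}" using v by (simp add: inner_sgn)
  from polarD[OF k(1) this] have "0 \<le> (k \<bullet> ?v) / norm ?v" by (simp only: inner_sgn)
  then have "0 \<le> k \<bullet> ?v" using v by (simp add: zero_le_divide_iff)
  moreover have "k \<bullet> ?v = d * (k \<bullet> x)" using e by (simp add: inner_add_right)
  ultimately show False using d x by (simp add: zero_le_mult_iff)
qed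

text \<open>A farthest pair of the polar of the cut is too far apart to lie in the polar of \<open>R\<close>. So one of
  its points, \<open>k\<close>, is new, and the semicircle center on the boundary of its hemisphere lies on the
  cutting circle. This center is the vector \<open>l - (k \<bullet> l) k\<close> up to its norm; being a point of \<open>R\<close>, it
  is non-negative on the polar.\<close>

lemma thin_lune_of_cut:
  assumes i: "i \<in> R" "0 < i \<bullet> y" and z: "z \<in> R" "z \<bullet> y < 0"
  shows "\<exists>k l. norm k = 1 \<and> norm l = 1 \<and> k \<bullet> l \<le> - cos (thickness R) \<and>
      (\<forall>x\<in>R. 0 \<le> x \<bullet> y \<longrightarrow> 0 \<le> k \<bullet> x \<and> 0 \<le> l \<bullet> x) \<and>
      (l - (k \<bullet> l) *\<^sub>R k) \<bullet> y = 0 \<and> (\<forall>d\<in>polar R. 0 \<le> (l - (k \<bullet> l) *\<^sub>R k) \<bullet> d)"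
proof -
  let ?Z = "{x \<in> R. 0 \<le> x \<bullet> y}"
  interpret Z: body ?Z by unfold_locales (rule cut_body[OF i])
  have tZ: "thickness ?Z < thickness R" by (rule thickness_cut[OF i z])
  obtain k0 l0 where kl0: "k0 \<in> polar ?Z" "l0 \<in> polar ?Z" "k0 \<bullet> l0 = - cos (thickness ?Z)"
    and min0: "\<forall>k'\<in>polar ?Z. \<forall>l'\<in>polar ?Z. k0 \<bullet> l0 \<le> k' \<bullet> l'"
    using Z.polar_inner_attained by blast
  have "cos (thickness R) < cos (thickness ?Z)"
    by (rule cos_monotone_0_pi) (use tZ thickness_bounds Z.thickness_bounds in auto)
  then have lt0: "k0 \<bullet> l0 < - cos (thickness R)" using kl0(3) by simp
  have "k0 \<notin> polar R \<or> l0 \<notin> polar R" using polar_inner_ge[of k0 l0] lt0 by auto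
  then obtain k l where kl: "k \<in> polar ?Z" "l \<in> polar ?Z" "k \<notin> polar R" "k \<bullet> l = k0 \<bullet> l0"
  proof (elim disjE)
    assume "k0 \<notin> polar R"
    then show thesis by (intro that[OF kl0(1,2)]) auto
  next
    assume "l0 \<notin> polar R"
    then show thesis by (intro that[OF kl0(2,1)]) (auto simp: inner_commute[of l0 k0])
  qed
  have lt: "k \<bullet> l < - cos (thickness R)" using lt0 kl by simp
  have min: "\<forall>y\<in>polar ?Z. l \<bullet> k \<le> l \<bullet> y"
    using min0 kl(2,4) inner_commute[of l k] by simp
  define f where "f = l - (k \<bullet> l) *\<^sub>R k"
  note F = Z.farthest_in_polar[OF kl(2,1) min, unfolded inner_commute[of l k], folded f_def]
  have f: "sgn f \<in> R" "0 \<le> sgn f \<bullet> y" "k \<bullet> f = 0"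
    using F(3,4) by (auto simp: inner_commute[of k f])
  have f0: "f \<noteq> 0"
  proof
    assume "f = 0"
    then show False using norm_1[OF f(1)] by simp
  qed
  have "sgn f \<bullet> y = 0"
    by (rule polar_meets_cut[OF cut_body[OF i] kl(1,3) f(1,2)]) (simp add: inner_sgn f(3))
  then have "f \<bullet> y = 0" using f0 by (simp add: inner_sgn)
  moreover have "0 \<le> f \<bullet> d" if "d \<in> polar R" for d
    using polarD'[OF that f(1)] f0 by (simp add: inner_sgn zero_le_divide_iff)
  moreover have "0 \<le> k \<bullet> x \<and> 0 \<le> l \<bullet> x" if "x \<in> R" "0 \<le> x \<bullet> y" for x
  proof -
    have "x \<in> ?Z" using that by simp
    from polarD[OF kl(1) this] polarD[OF kl(2) this] show ?thesis by simp
  qed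
  ultimately show ?thesis
    using polar_norm[OF kl(1)] polar_norm[OF kl(2)] lt unfolding f_def
    by (intro exI[of _ k] exI[of _ l]) auto
qed

text \<open>Push the center \<open>k0\<close> slightly away from \<open>R\<close> and cut. As the cuts shrink, the thin lunes around
  the remaining bodies converge to a lune of thickness \<open>\<Delta>\<close> around \<open>R\<close>, with a center on the great
  circle of \<open>k0\<close>.\<close>

lemma support_touches_thin_point:
  assumes k0: "k0 \<in> polar R" and z: "z \<in> R" "k0 \<bullet> z = 0"
  shows "\<exists>e\<in>thin_points. k0 \<bullet> e = 0"
proof -
  define C where "C = cos (thickness R)"
  define S where "S = sin (thickness R)"
  have CS: "C\<^sup>2 + S\<^sup>2 = 1" "0 < S" using sin_thickness by (simp_all add: C_def S_def)
  obtain w where w: "\<forall>x\<in>R. 0 < w \<bullet> x" using open_hemisphere_around[OF conv cpt] by blast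
  obtain i where i: "i \<in> R" "\<forall>k\<in>polar R. 0 < k \<bullet> i" using interior_point by blast
  have k0i: "0 < k0 \<bullet> i" using i k0 by blast
  (* the interior point i must stay strictly on the kept side of every cut *)
  define d0 where "d0 = (k0 \<bullet> i) / (2 * (w \<bullet> i))"
  have wi: "0 < w \<bullet> i" using w i by blast
  have d0: "0 < d0" "d0 * (w \<bullet> i) < k0 \<bullet> i" using k0i wi by (simp_all add: d0_def)
  define y where "y n = k0 - (d0 / real (Suc n)) *\<^sub>R w" for n
  have dn: "0 < d0 / real (Suc n)" "d0 / real (Suc n) \<le> d0" for n
    using d0 by (simp_all add: field_simps)
  have ylim: "y \<longlonglongrightarrow> k0"
  proof -
    have "(\<lambda>n. d0 / real (Suc n)) \<longlonglongrightarrow> 0"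
      using LIMSEQ_Suc[OF lim_const_over_n[of d0]] by simp
    from tendsto_diff[OF tendsto_const[of k0] tendsto_scaleR[OF this tendsto_const[of w]]]
    show ?thesis unfolding y_def by simp
  qed
  have "\<exists>q. \<forall>n. norm (fst (q n)) = 1 \<and> norm (snd (q n)) = 1 \<and> fst (q n) \<bullet> snd (q n) \<le> - C \<and>
      (\<forall>x\<in>R. 0 \<le> x \<bullet> y n \<longrightarrow> 0 \<le> fst (q n) \<bullet> x \<and> 0 \<le> snd (q n) \<bullet> x) \<and>
      (snd (q n) - (fst (q n) \<bullet> snd (q n)) *\<^sub>R fst (q n)) \<bullet> y n = 0 \<and>
      (\<forall>d\<in>polar R. 0 \<le> (snd (q n) - (fst (q n) \<bullet> snd (q n)) *\<^sub>R fst (q n)) \<bullet> d)"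
  proof (rule choice, intro allI)
    fix n
    have "(d0 / real (Suc n)) * (w \<bullet> i) \<le> d0 * (w \<bullet> i)"
      using dn[of n] wi by (intro mult_right_mono) auto
    with d0 have "0 < i \<bullet> y n" by (simp add: y_def inner_diff_right inner_commute[of i])
    moreover have "z \<bullet> y n < 0"
      using z w dn[of n] by (simp add: y_def inner_diff_right inner_commute[of z])
    ultimately obtain k l where "norm k = 1 \<and> norm l = 1 \<and> k \<bullet> l \<le> - C \<and>
      (\<forall>x\<in>R. 0 \<le> x \<bullet> y n \<longrightarrow> 0 \<le> k \<bullet> x \<and> 0 \<le> l \<bullet> x) \<and>
      (l - (k \<bullet> l) *\<^sub>R k) \<bullet> y n = 0 \<and> (\<forall>d\<in>polar R. 0 \<le> (l - (k \<bullet> l) *\<^sub>R k) \<bullet> d)"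
      using thin_lune_of_cut[OF i(1) _ z(1)] unfolding C_def by blast
    then show "\<exists>q. norm (fst q) = 1 \<and> norm (snd q) = 1 \<and> fst q \<bullet> snd q \<le> - C \<and>
      (\<forall>x\<in>R. 0 \<le> x \<bullet> y n \<longrightarrow> 0 \<le> fst q \<bullet> x \<and> 0 \<le> snd q \<bullet> x) \<and>
      (snd q - (fst q \<bullet> snd q) *\<^sub>R fst q) \<bullet> y n = 0 \<and>
      (\<forall>d\<in>polar R. 0 \<le> (snd q - (fst q \<bullet> snd q) *\<^sub>R fst q) \<bullet> d)"
      by (intro exI[of _ "(k, l)"]) simp
  qed
  then obtain q where q: "\<And>n. norm (fst (q n)) = 1" "\<And>n. norm (snd (q n)) = 1"
      "\<And>n. fst (q n) \<bullet> snd (q n) \<le> - C"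
      "\<And>n x. x \<in> R \<Longrightarrow> 0 \<le> x \<bullet> y n \<Longrightarrow> 0 \<le> fst (q n) \<bullet> x \<and> 0 \<le> snd (q n) \<bullet> x"
      "\<And>n. (snd (q n) - (fst (q n) \<bullet> snd (q n)) *\<^sub>R fst (q n)) \<bullet> y n = 0"
      "\<And>n d. d \<in> polar R \<Longrightarrow> 0 \<le> (snd (q n) - (fst (q n) \<bullet> snd (q n)) *\<^sub>R fst (q n)) \<bullet> d"
    by blast
  have "compact (S2 \<times> S2)" by (intro compact_Times compact_sphere)
  moreover have "\<forall>n. q n \<in> S2 \<times> S2" using q(1,2) by (simp add: mem_Times_iff)
  ultimately obtain kl r where kl: "kl \<in> S2 \<times> S2" "strict_mono r" "(q \<circ> r) \<longlonglongrightarrow> kl"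
    unfolding compact_def by meson
  define k l where "k = fst kl" and "l = snd kl"
  have n: "norm k = 1" "norm l = 1" using kl(1) by (auto simp: k_def l_def mem_Times_iff)
  note u = inner_unit_self[OF n(1)] inner_unit_self[OF n(2)]
  have kn: "(\<lambda>n. fst (q (r n))) \<longlonglongrightarrow> k" and ln: "(\<lambda>n. snd (q (r n))) \<longlonglongrightarrow> l"
    using tendsto_fst[OF kl(3)] tendsto_snd[OF kl(3)] by (simp_all add: k_def l_def)
  have yn: "(\<lambda>n. y (r n)) \<longlonglongrightarrow> k0"
    using LIMSEQ_subseq_LIMSEQ[OF ylim kl(2)] by (simp add: o_def)
  have near: "0 \<le> k \<bullet> x \<and> 0 \<le> l \<bullet> x" if x: "x \<in> R" "0 < k0 \<bullet> x" for x
  proof -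
    have "(\<lambda>n. x \<bullet> y (r n)) \<longlonglongrightarrow> x \<bullet> k0" by (intro tendsto_intros yn)
    then have "\<forall>\<^sub>F n in sequentially. 0 < x \<bullet> y (r n)"
      by (rule order_tendstoD(1)) (use x in \<open>simp add: inner_commute\<close>)
    then have ev: "\<forall>\<^sub>F n in sequentially. 0 \<le> fst (q (r n)) \<bullet> x \<and> 0 \<le> snd (q (r n)) \<bullet> x"
      by (rule eventually_mono) (use q(4) x in force)
    have "(\<lambda>n. fst (q (r n)) \<bullet> x) \<longlonglongrightarrow> k \<bullet> x" "(\<lambda>n. snd (q (r n)) \<bullet> x) \<longlonglongrightarrow> l \<bullet> x"
      by (intro tendsto_intros kn ln)+
    then show ?thesis
      using ev by (auto intro!: tendsto_lowerbound elim!: eventually_mono)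
  qed
  (* points on the great circle of k0 may be cut off at every stage, so they are approached through
     the interior point i *)
  have nonneg: "0 \<le> k \<bullet> x \<and> 0 \<le> l \<bullet> x" if x: "x \<in> R" for x
  proof -
    have "0 \<le> k \<bullet> x + e * (k \<bullet> i) \<and> 0 \<le> l \<bullet> x + e * (l \<bullet> i)" if e: "0 < e" for e
    proof -
      let ?v = "1 *\<^sub>R x + e *\<^sub>R i"
      have v: "?v \<noteq> 0" "sgn ?v \<in> R"
        using conic_combination[OF conv x i(1), of 1 e] e by auto
      have "0 < k0 \<bullet> ?v" using polarD[OF k0 x] k0i e by (simp add: inner_add_right add_nonneg_pos)
      then have "0 < k0 \<bullet> sgn ?v" using v by (simp add: inner_sgn)
      from near[OF v(2) this] have "0 \<le> k \<bullet> ?v" "0 \<le> l \<bullet> ?v"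
        using v(1) by (simp_all add: inner_sgn zero_le_divide_iff)
      then show ?thesis by (simp add: inner_add_right)
    qed
    then have e: "0 \<le> k \<bullet> x + e * (k \<bullet> i)" "0 \<le> l \<bullet> x + e * (l \<bullet> i)" if "0 < e" for e
      using that by auto
    have "0 \<le> a" if "\<And>e. 0 < e \<Longrightarrow> 0 \<le> a + e * b" for a b :: real
    proof (rule field_le_epsilon)
      fix d :: real assume "0 < d"
      define e where "e = d / (\<bar>b\<bar> + 1)"
      have "0 < e" using \<open>0 < d\<close> by (simp add: e_def)
      have "e * b \<le> e * (\<bar>b\<bar> + 1)" using \<open>0 < e\<close> by (intro mult_left_mono) auto
      also have "\<dots> = d" by (simp add: e_def field_simps add_pos_nonneg)
      finally show "0 \<le> a + d" using that[OF \<open>0 < e\<close>] by linarith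
    qed
    with e show ?thesis by blast
  qed
  have kD: "k \<in> polar R" and lD: "l \<in> polar R" using nonneg n by (auto simp: polar_def)
  have cn: "(\<lambda>n. fst (q (r n)) \<bullet> snd (q (r n))) \<longlonglongrightarrow> k \<bullet> l" by (intro tendsto_intros kn ln)
  then have "k \<bullet> l \<le> - C" by (rule tendsto_upperbound) (use q(3) in auto)
  moreover have "- C \<le> k \<bullet> l" using polar_inner_ge[OF kD lD] by (simp add: C_def)
  ultimately have kl_C: "k \<bullet> l = - C" by simp
  define f where "f = l - (k \<bullet> l) *\<^sub>R k"
  have fn: "(\<lambda>n. snd (q (r n)) - (fst (q (r n)) \<bullet> snd (q (r n))) *\<^sub>R fst (q (r n))) \<longlonglongrightarrow> f"
    unfolding f_def by (intro tendsto_intros kn ln)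
  have "(\<lambda>n. (snd (q (r n)) - (fst (q (r n)) \<bullet> snd (q (r n))) *\<^sub>R fst (q (r n))) \<bullet> y (r n)) \<longlonglongrightarrow> f \<bullet> k0"
    by (intro tendsto_intros fn yn)
  then have fk0: "f \<bullet> k0 = 0" using q(5) by (simp add: LIMSEQ_const_iff)
  have fd: "0 \<le> f \<bullet> d" if "d \<in> polar R" for d
  proof -
    have "(\<lambda>n. (snd (q (r n)) - (fst (q (r n)) \<bullet> snd (q (r n))) *\<^sub>R fst (q (r n))) \<bullet> d) \<longlonglongrightarrow> f \<bullet> d"
      by (intro tendsto_intros fn)
    then show ?thesis by (rule tendsto_lowerbound) (use q(6)[OF that] in auto)
  qed
  have f: "f = l + C *\<^sub>R k" by (simp add: f_def kl_C)
  have "f \<bullet> f = 1 - C\<^sup>2"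
    using u kl_C by (simp add: f inner_add_left inner_add_right inner_commute[of l k] power2_eq_square)
  also have "\<dots> = S\<^sup>2" using CS by simp
  finally have nf: "norm f = S" using CS(2) by (simp add: norm_eq_sqrt_inner)
  define e where "e = (1 / S) *\<^sub>R f"
  have Se: "S *\<^sub>R e = f" using CS by (simp add: e_def)
  have eR: "e \<in> R"
  proof (rule bipolar[OF conv cpt])
    show "norm e = 1" using nf CS by (simp add: e_def)
    show "0 \<le> d \<bullet> e" if "d \<in> polar R" for d
      using fd[OF that] CS by (simp add: e_def inner_commute)
  qed
  have "k \<bullet> e = 0" using u kl_C by (simp add: e_def f inner_add_right)
  moreover have "S *\<^sub>R e - C *\<^sub>R k = l" using Se f by simp
  ultimately have "e \<in> thin_points"
    unfolding thin_points_def using eR kD lD by (auto simp: C_def S_def)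
  moreover have "k0 \<bullet> e = 0" using fk0 by (simp add: e_def inner_commute)
  ultimately show ?thesis by blast
qed

lemma compact_thin_points: "compact thin_points"
proof -
  let ?h = "\<lambda>p::(real^3) \<times> (real^3). sin (thickness R) *\<^sub>R fst p - cos (thickness R) *\<^sub>R snd p"
  have "closed {p::(real^3) \<times> (real^3). snd p \<bullet> fst p = 0}"
    by (intro closed_Collect_eq continuous_intros)
  moreover have "closed (?h -` polar R)"
    by (intro closed_vimage compact_imp_closed compact_polar continuous_intros)
  ultimately have "compact ((R \<times> polar R) \<inter> ({p. snd p \<bullet> fst p = 0} \<inter> ?h -` polar R))"
    by (intro compact_Int_closed compact_Times cpt compact_polar closed_Int)
  then have "compact (fst ` ((R \<times> polar R) \<inter> ({p. snd p \<bullet> fst p = 0} \<inter> ?h -` polar R)))"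
    by (intro compact_continuous_image continuous_intros)
  moreover have "fst ` ((R \<times> polar R) \<inter> ({p. snd p \<bullet> fst p = 0} \<inter> ?h -` polar R)) = thin_points"
    unfolding thin_points_def by force
  ultimately show ?thesis by simp
qed

lemma thin_points_subset: "thin_points \<subseteq> R"
  by (auto simp: thin_points_def)

text \<open>Otherwise some \<open>y\<close> is positive on the thin points and negative at \<open>x\<close>. Adding a multiple of
  \<open>w\<close>, which is positive on \<open>R\<close>, until \<open>R\<close> is just supported keeps the thin points strictly inside
  the hemisphere, so the supporting great circle contains none of them.\<close>

lemma thin_points_span:
  assumes x: "x \<in> R"
  shows "\<exists>t. 0 < t \<and> t \<le> 1 \<and> t *\<^sub>R x \<in> convex hull thin_points"
proof -
  have E1: "norm e = 1" if "e \<in> thin_points" for e using that thin_points_subset norm_1 by blast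
  have "\<exists>t\<ge>0. t *\<^sub>R x \<in> convex hull thin_points"
  proof (rule ccontr)
    assume "\<not> ?thesis"
    then have "\<exists>a. a \<bullet> x < 0 \<and> (\<forall>e\<in>thin_points. 0 < a \<bullet> e)"
      by (intro separate_ray_from_hull compact_thin_points E1 norm_1[OF x]) auto
    then obtain y where y: "y \<bullet> x < 0" "\<forall>e\<in>thin_points. 0 < y \<bullet> e" by blast
    obtain w where w: "\<forall>x\<in>R. 0 < w \<bullet> x" using open_hemisphere_around[OF conv cpt] by blast
    have "continuous_on R (\<lambda>x. - (y \<bullet> x) / (w \<bullet> x))"
      using w by (intro continuous_intros) auto
    then have "\<exists>z\<in>R. \<forall>x\<in>R. - (y \<bullet> x) / (w \<bullet> x) \<le> - (y \<bullet> z) / (w \<bullet> z)"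
      using x by (intro continuous_attains_sup cpt) auto
    then obtain z where z: "z \<in> R" and max: "\<forall>x\<in>R. - (y \<bullet> x) / (w \<bullet> x) \<le> - (y \<bullet> z) / (w \<bullet> z)"
      by blast
    define t where "t = - (y \<bullet> z) / (w \<bullet> z)"
    have "0 < - (y \<bullet> x) / (w \<bullet> x)" using y w x by (intro divide_pos_pos) auto
    then have t: "0 < t" using max x by (force simp: t_def)
    define v where "v = y + t *\<^sub>R w"
    have vR: "0 \<le> v \<bullet> p" if "p \<in> R" for p
    proof -
      have "- (y \<bullet> p) / (w \<bullet> p) \<le> t" using max that by (simp add: t_def)
      moreover have "0 < w \<bullet> p" using w that by blast
      ultimately have "- (y \<bullet> p) \<le> t * (w \<bullet> p)" by (subst (asm) pos_divide_le_eq)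
      then show ?thesis by (simp add: v_def inner_add_left)
    qed
    have "w \<bullet> z \<noteq> 0" using w z by force
    then have vz: "v \<bullet> z = 0" by (simp add: v_def inner_add_left) (simp add: t_def)
    have vE: "0 < v \<bullet> e" if "e \<in> thin_points" for e
    proof -
      have "0 < t * (w \<bullet> e)" using w t that thin_points_subset by auto
      then show ?thesis using y(2) that by (simp add: v_def inner_add_left add_pos_pos)
    qed
    have "thin_points \<noteq> {}"
    proof -
      obtain k l where kl: "k \<in> polar R" "l \<in> polar R" and min: "\<forall>k'\<in>polar R. \<forall>l'\<in>polar R. k \<bullet> l \<le> k' \<bullet> l'"
        using polar_inner_attained by blast
      have "\<forall>y\<in>polar R. k \<bullet> l \<le> k \<bullet> y" using min kl by blast
      note f = farthest_in_polar(3,4)[OF kl this]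
      have "l \<bullet> sgn (k - (k \<bullet> l) *\<^sub>R l) = 0" using f(2) by (simp add: inner_sgn inner_commute[of l])
      from support_touches_thin_point[OF kl(2) f(1) this] show ?thesis by blast
    qed
    then have v0: "v \<noteq> 0" using vE by force
    then have "sgn v \<in> polar R" using vR by (simp add: polar_def norm_sgn inner_sgn)
    moreover have "sgn v \<bullet> z = 0" using vz by (simp add: inner_sgn)
    ultimately obtain e where "e \<in> thin_points" "sgn v \<bullet> e = 0"
      using support_touches_thin_point[OF _ z] by blast
    then show False using vE v0 by (force simp: inner_sgn)
  qed
  then obtain t where t: "0 \<le> t" "t *\<^sub>R x \<in> convex hull thin_points" by blast
  have "convex hull thin_points \<subseteq> convex hull R" by (rule hull_mono[OF thin_points_subset])
  then have "t *\<^sub>R x \<noteq> 0" using hull_on_rays(1)[OF conv] t(2) by blast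
  moreover have "convex hull thin_points \<subseteq> cball 0 1"
    using E1 by (intro hull_minimal convex_cball) auto
  then have "norm (t *\<^sub>R x) \<le> 1" using t(2) by auto
  ultimately show ?thesis using t norm_1[OF x] by (intro exI[of _ t]) auto
qed

text \<open>The opposite center of the thin lune of \<open>e\<close>. It is in \<open>R\<close> by the first-order condition. A
  point of the lune has non-negative products with \<open>k\<close> and \<open>l\<close>, and up to the factor \<open>sin \<Delta>\<close> these
  are the coordinates of its projection in the basis of the two centers.\<close>

lemma thin_point_opposite:
  assumes e: "e \<in> R" and k: "k \<in> polar R" "k \<bullet> e = 0"
    and l: "sin (thickness R) *\<^sub>R e - cos (thickness R) *\<^sub>R k \<in> polar R"
  shows "cos (thickness R) *\<^sub>R e + sin (thickness R) *\<^sub>R k \<in> R"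
    "norm (cos (thickness R) *\<^sub>R e + sin (thickness R) *\<^sub>R k) = 1"
    "e \<bullet> (cos (thickness R) *\<^sub>R e + sin (thickness R) *\<^sub>R k) = cos (thickness R)"
    "\<And>x. x \<in> R \<Longrightarrow> projects_into x e (cos (thickness R) *\<^sub>R e + sin (thickness R) *\<^sub>R k)"
proof -
  define C where "C = cos (thickness R)"
  define S where "S = sin (thickness R)"
  define f where "f = C *\<^sub>R e + S *\<^sub>R k"
  define l where "l = S *\<^sub>R e - C *\<^sub>R k"
  have lD: "l \<in> polar R" using assms(4) by (simp add: l_def C_def S_def)
  have CS: "C\<^sup>2 + S\<^sup>2 = 1" "0 < S" using sin_thickness by (simp_all add: C_def S_def)
  have CS': "C * C + S * S = 1" using CS by (simp add: power2_eq_square)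
  note u = inner_unit_self[OF norm_1[OF e]] inner_unit_self[OF polar_norm[OF k(1)]]
  have ek: "e \<bullet> k = 0" using k(2) by (simp add: inner_commute)
  have ff: "f \<bullet> f = 1" using u ek k CS' by (simp add: f_def inner_add_left inner_add_right)
  then have nf: "norm f = 1" by (simp add: norm_eq_1)
  have kl: "k \<bullet> l = - C" using k u by (simp add: l_def inner_diff_right)
  have "\<forall>y\<in>polar R. k \<bullet> l \<le> k \<bullet> y" using polar_inner_ge[OF k(1)] kl by (simp add: C_def)
  note F = farthest_in_polar(3)[OF k(1) lD this]
  have "k - (k \<bullet> l) *\<^sub>R l = (C * S) *\<^sub>R e + (1 - C * C) *\<^sub>R k"
    unfolding kl by (simp add: l_def algebra_simps)
  also have "1 - C * C = S * S" using CS' by simp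
  finally have "k - (k \<bullet> l) *\<^sub>R l = S *\<^sub>R f" by (simp add: f_def algebra_simps)
  with F have "sgn (S *\<^sub>R f) \<in> R" by simp
  then have fR: "f \<in> R" using CS(2) nf by (simp add: sgn_scaleR sgn_div_norm)
  have ef: "e \<bullet> f = C" using u ek by (simp add: f_def inner_add_right)
  have pr: "projects_into x e f" if x: "x \<in> R" for x
    unfolding projects_into_def
  proof (rule exI[of _ "(x \<bullet> l) / S"], intro conjI exI[of _ "(x \<bullet> k) / S"])
    show "0 \<le> x \<bullet> l / S" "0 \<le> x \<bullet> k / S"
      using polarD'[OF lD x] polarD'[OF k(1) x] CS by auto
    have xl: "x \<bullet> l = S * (x \<bullet> e) - C * (x \<bullet> k)" by (simp add: l_def inner_diff_right)
    have eq: "(x \<bullet> l / S) *\<^sub>R e + (x \<bullet> k / S) *\<^sub>R f = (x \<bullet> e) *\<^sub>R e + (x \<bullet> k) *\<^sub>R k"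
      using CS(2) by (simp add: xl f_def scaleR_add_right diff_divide_distrib scaleR_diff_left)
    have "(x - ((x \<bullet> e) *\<^sub>R e + (x \<bullet> k) *\<^sub>R k)) \<bullet> e = 0" "(x - ((x \<bullet> e) *\<^sub>R e + (x \<bullet> k) *\<^sub>R k)) \<bullet> k = 0"
      using u k ek by (simp_all add: inner_diff_left inner_add_left)
    then show "(x - ((x \<bullet> l / S) *\<^sub>R e + (x \<bullet> k / S) *\<^sub>R f)) \<bullet> e = 0"
      "(x - ((x \<bullet> l / S) *\<^sub>R e + (x \<bullet> k / S) *\<^sub>R f)) \<bullet> f = 0"
      unfolding eq by (simp_all add: f_def inner_add_right)
  qed
  from fR nf ef pr show "cos (thickness R) *\<^sub>R e + sin (thickness R) *\<^sub>R k \<in> R"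
    "norm (cos (thickness R) *\<^sub>R e + sin (thickness R) *\<^sub>R k) = 1"
    "e \<bullet> (cos (thickness R) *\<^sub>R e + sin (thickness R) *\<^sub>R k) = cos (thickness R)"
    "\<And>x. x \<in> R \<Longrightarrow> projects_into x e (cos (thickness R) *\<^sub>R e + sin (thickness R) *\<^sub>R k)"
    by (simp_all add: f_def C_def S_def)
qed

text \<open>In the case of equality the common opposite center is \<open>p\<close>, and \<open>u\<close> and \<open>v\<close> are the second
  hemisphere centers of the two lunes.\<close>

lemma thin_points_inner:
  assumes thin: "thickness R < pi / 2" and e: "e1 \<in> thin_points" "e2 \<in> thin_points"
  shows "(cos (thickness R))\<^sup>2 \<le> e1 \<bullet> e2"
    "e1 \<bullet> e2 = (cos (thickness R))\<^sup>2 \<Longrightarrow> \<exists>p\<in>R. \<exists>u\<in>polar R. \<exists>v\<in>polar R.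
       p \<bullet> u = 0 \<and> p \<bullet> v = 0 \<and> u \<bullet> v = 0 \<and>
       e1 = cos (thickness R) *\<^sub>R p + sin (thickness R) *\<^sub>R u \<and>
       e2 = cos (thickness R) *\<^sub>R p + sin (thickness R) *\<^sub>R v"
proof -
  define C where "C = cos (thickness R)"
  define S where "S = sin (thickness R)"
  have S0: "0 < S" using sin_thickness by (simp add: S_def)
  have CS: "C * C + S * S = 1" by (simp add: C_def S_def flip: power2_eq_square)
  have C0: "0 < C" unfolding C_def using thin thickness_bounds by (intro cos_gt_zero) auto
  have "0 < S * S" using S0 by simp
  then have "C * C < 1" using CS by linarith
  then have C1: "C < 1" using C0 mult_mono[of 1 C 1 C] by force
  obtain k1 where k1: "e1 \<in> R" "k1 \<in> polar R" "k1 \<bullet> e1 = 0" "S *\<^sub>R e1 - C *\<^sub>R k1 \<in> polar R"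
    using e(1) by (auto simp: thin_points_def C_def S_def)
  obtain k2 where k2: "e2 \<in> R" "k2 \<in> polar R" "k2 \<bullet> e2 = 0" "S *\<^sub>R e2 - C *\<^sub>R k2 \<in> polar R"
    using e(2) by (auto simp: thin_points_def C_def S_def)
  define f1 f2 where "f1 = C *\<^sub>R e1 + S *\<^sub>R k1" and "f2 = C *\<^sub>R e2 + S *\<^sub>R k2"
  note o1 = thin_point_opposite[OF k1(1-3), folded C_def S_def, OF k1(4), folded f1_def]
  note o2 = thin_point_opposite[OF k2(1-3), folded C_def S_def, OF k2(4), folded f2_def]
  note ends = projecting_arcs_ends[OF norm_1[OF k1(1)] o1(2,3) norm_1[OF k2(1)] o2(2,3) C0 C1
      o1(4)[OF k2(1)] o1(4)[OF o2(1)] o2(4)[OF k1(1)] o2(4)[OF o1(1)]]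
  show "(cos (thickness R))\<^sup>2 \<le> e1 \<bullet> e2" using ends(1) by (simp add: C_def)
  assume "e1 \<bullet> e2 = (cos (thickness R))\<^sup>2"
  then have "e1 \<bullet> e2 = C\<^sup>2" by (simp add: C_def)
  from ends(2)[OF this] have f12: "f1 = f2" and perp: "(e2 - C *\<^sub>R f1) \<bullet> e1 = 0" by auto
  define u v where "u = S *\<^sub>R e1 - C *\<^sub>R k1" and "v = S *\<^sub>R e2 - C *\<^sub>R k2"
  note n1 = inner_unit_self[OF norm_1[OF k1(1)]] inner_unit_self[OF polar_norm[OF k1(2)]]
  note n2 = inner_unit_self[OF norm_1[OF k2(1)]] inner_unit_self[OF polar_norm[OF k2(2)]]
  have rot: "C *\<^sub>R (C *\<^sub>R e + S *\<^sub>R k) + S *\<^sub>R (S *\<^sub>R e - C *\<^sub>R k) = e" for e k :: "real^3"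
  proof -
    have "C *\<^sub>R (C *\<^sub>R e + S *\<^sub>R k) + S *\<^sub>R (S *\<^sub>R e - C *\<^sub>R k) = (C * C + S * S) *\<^sub>R e"
      by (simp add: algebra_simps)
    then show ?thesis using CS by simp
  qed
  have e1: "e1 = C *\<^sub>R f1 + S *\<^sub>R u" unfolding f1_def u_def by (simp only: rot)
  have e2: "e2 = C *\<^sub>R f1 + S *\<^sub>R v" unfolding f12 unfolding f2_def v_def by (simp only: rot)
  have fu: "f1 \<bullet> u = 0"
    using k1(3) n1 by (simp add: f1_def u_def inner_add_left inner_diff_right inner_commute[of e1 k1])
  have fv: "f1 \<bullet> v = 0" unfolding f12
    using k2(3) n2 by (simp add: f2_def v_def inner_add_left inner_diff_right inner_commute[of e2 k2])
  have "S *\<^sub>R v = e2 - C *\<^sub>R f1" using e2 by simp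
  with perp have "v \<bullet> e1 = 0" using S0 by (metis inner_scaleR_left mult_eq_0_iff order_less_irrefl)
  then have "u \<bullet> v = 0" using S0 fv
    by (simp add: e1 inner_add_right inner_commute[of v])
  with k1(4) k2(4) o1(1) e1 e2 fu fv show "\<exists>p\<in>R. \<exists>u\<in>polar R. \<exists>v\<in>polar R.
       p \<bullet> u = 0 \<and> p \<bullet> v = 0 \<and> u \<bullet> v = 0 \<and>
       e1 = cos (thickness R) *\<^sub>R p + sin (thickness R) *\<^sub>R u \<and>
       e2 = cos (thickness R) *\<^sub>R p + sin (thickness R) *\<^sub>R v"
    unfolding C_def[symmetric] S_def[symmetric] u_def[symmetric] v_def[symmetric] by blast
qed

text \<open>Points of \<open>R\<close> are non-negative combinations of thin points whose coefficients have sum at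
  least \<open>1\<close>, so the bound for thin points carries over. Equality needs coefficient sum \<open>1\<close>, that is,
  a unit vector in a convex hull of unit vectors, which must be one of them.\<close>

lemma inner_ge_thin:
  assumes thin: "thickness R < pi / 2" and xy: "x \<in> R" "y \<in> R"
  shows "(cos (thickness R))\<^sup>2 \<le> x \<bullet> y"
    "x \<bullet> y = (cos (thickness R))\<^sup>2 \<Longrightarrow> x \<in> thin_points \<and> y \<in> thin_points"
proof -
  define C where "C = cos (thickness R)"
  have C0: "0 < C" unfolding C_def using thin thickness_bounds by (intro cos_gt_zero) auto
  obtain t where t: "0 < t" "t \<le> 1" "t *\<^sub>R x \<in> convex hull thin_points"
    using thin_points_span[OF xy(1)] by blast
  obtain s where s: "0 < s" "s \<le> 1" "s *\<^sub>R y \<in> convex hull thin_points"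
    using thin_points_span[OF xy(2)] by blast
  have "C\<^sup>2 \<le> (t *\<^sub>R x) \<bullet> (s *\<^sub>R y)"
    by (rule hull_inner_ge[OF _ t(3) s(3)]) (use thin_points_inner(1)[OF thin] in \<open>simp add: C_def\<close>)
  then have ge: "C\<^sup>2 \<le> (t * s) * (x \<bullet> y)" by (simp add: mult_ac)
  have ts: "0 < t * s" "t * s \<le> 1" using t s by (auto simp: mult_le_one)
  have C2: "0 < C\<^sup>2" using C0 by simp
  have "0 < (t * s) * (x \<bullet> y)" using ge C2 by linarith
  then have "0 < x \<bullet> y" using ts by (simp add: zero_less_mult_iff)
  then have le: "(t * s) * (x \<bullet> y) \<le> 1 * (x \<bullet> y)" using ts by (intro mult_right_mono) auto
  then have "C\<^sup>2 \<le> x \<bullet> y" using ge by linarith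
  then show "(cos (thickness R))\<^sup>2 \<le> x \<bullet> y" by (simp add: C_def)
  assume "x \<bullet> y = (cos (thickness R))\<^sup>2"
  then have "x \<bullet> y = C\<^sup>2" by (simp add: C_def)
  with ge C2 have "1 \<le> t * s" by simp
  moreover have "t * s \<le> t * 1" "t * s \<le> 1 * s" using t s by (auto intro!: mult_left_mono mult_right_mono)
  ultimately have "t = 1" "s = 1" using t s by linarith+
  moreover have "p \<in> thin_points" if p: "p \<in> convex hull thin_points" "norm p = 1" for p
  proof -
    have sub: "convex hull thin_points \<subseteq> cball 0 1"
      using thin_points_subset norm_1 by (intro hull_minimal convex_cball) auto
    have "p extreme_point_of (convex hull thin_points)"
      unfolding extreme_point_of_def
    proof (intro conjI ballI p(1))
      fix a b assume "a \<in> convex hull thin_points" "b \<in> convex hull thin_points"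
      then have "dist 0 a \<le> 1" "dist 0 b \<le> 1" using sub by auto
      then show "p \<notin> open_segment a b"
        using dist_decreases_open_segment[of p a b 0] p(2) by auto
    qed
    then show ?thesis by (rule extreme_point_of_convex_hull)
  qed
  ultimately show "x \<in> thin_points \<and> y \<in> thin_points"
    using t(3) s(3) xy norm_1 by auto
qed

end

section \<open>Quarters of disks\<close>

lemma cauchy_schwarz_plane: "a * b + c * d \<le> sqrt (a\<^sup>2 + c\<^sup>2) * sqrt (b\<^sup>2 + d\<^sup>2)" for a b c d :: real
proof -
  have "(a * b + c * d)\<^sup>2 \<le> (a\<^sup>2 + c\<^sup>2) * (b\<^sup>2 + d\<^sup>2)"
  proof -
    have "(a\<^sup>2 + c\<^sup>2) * (b\<^sup>2 + d\<^sup>2) - (a * b + c * d)\<^sup>2 = (a * d - b * c)\<^sup>2"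
      by (simp add: power2_eq_square algebra_simps)
    then show ?thesis by (smt (verit) zero_le_power2)
  qed
  then have "a * b + c * d \<le> sqrt ((a\<^sup>2 + c\<^sup>2) * (b\<^sup>2 + d\<^sup>2))" by (rule real_le_rsqrt)
  then show ?thesis by (simp add: real_sqrt_mult)
qed

locale quarter =
  fixes p u v :: "real^3" and \<rho> :: real
  assumes unit: "norm p = 1" "norm u = 1" "norm v = 1"
    and orth: "p \<bullet> u = 0" "p \<bullet> v = 0" "u \<bullet> v = 0"
    and radius: "0 < \<rho>" "\<rho> < pi / 2"
begin

definition Q where "Q = disk p \<rho> \<inter> hemisphere u \<inter> hemisphere v"

lemma Q_eq: "Q = {x \<in> S2. cos \<rho> \<le> x \<bullet> p \<and> 0 \<le> x \<bullet> u \<and> 0 \<le> x \<bullet> v}"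
proof -
  have "(arccos (p \<bullet> x) \<le> \<rho>) = (cos \<rho> \<le> x \<bullet> p)" if "norm x = 1" for x
  proof -
    have "arccos (cos \<rho>) = \<rho>" using radius by (simp add: arccos_cos)
    then show ?thesis
      using arccos_le_mono[of "p \<bullet> x" "cos \<rho>"] inner_unit_bounds[OF unit(1) that]
      by (simp add: abs_le_iff inner_commute minus_le_iff)
  qed
  then show ?thesis
    using unit unfolding Q_def by (auto simp: hemisphere_eq disk_def sph_dist_def inner_commute)
qed

lemma cos_sin: "0 < cos \<rho>" "0 < sin \<rho>" "cos \<rho> * cos \<rho> + sin \<rho> * sin \<rho> = 1"
  using radius cos_gt_zero[of \<rho>] sin_gt_zero[of \<rho>] sin_cos_squared_add[of \<rho>] by (auto simp: power2_eq_square add.commute)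

lemmas expansion = orthonormal_inner[OF unit orth]

lemmas selfs = inner_unit_self[OF unit(1)] inner_unit_self[OF unit(2)] inner_unit_self[OF unit(3)]

lemma combination_in_Q:
  assumes "0 \<le> a" "0 \<le> b" "c\<^sup>2 + a\<^sup>2 + b\<^sup>2 = 1" "cos \<rho> \<le> c"
  shows "c *\<^sub>R p + a *\<^sub>R u + b *\<^sub>R v \<in> Q"
proof -
  let ?x = "c *\<^sub>R p + a *\<^sub>R u + b *\<^sub>R v"
  have co: "?x \<bullet> p = c" "?x \<bullet> u = a" "?x \<bullet> v = b"
    using selfs orth by (simp_all add: inner_add_left inner_commute[of u p] inner_commute[of v p] inner_commute[of v u])
  have "?x \<bullet> ?x = 1" using expansion[of ?x ?x] assms(3) unfolding co by (simp add: power2_eq_square)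
  then have "norm ?x = 1" by (simp add: norm_eq_1)
  then show ?thesis unfolding Q_eq using co assms by simp
qed

lemma convex_body_Q: "sph_convex_body Q"
proof -
  let ?P = "{x. cos \<rho> \<le> x \<bullet> p} \<inter> {x. 0 \<le> x \<bullet> u} \<inter> {x. 0 \<le> x \<bullet> v}"
  have Q: "Q = S2 \<inter> ?P" unfolding Q_eq by blast
  have "closed ?P"
    by (intro closed_Int closed_Collect_le continuous_intros)
  then have "closedin (top_of_set S2) Q" unfolding Q by (rule closedin_closed_Int)
  moreover have "sph_convex Q"
    unfolding sph_convex_def
  proof (intro conjI ballI)
    show "Q \<subseteq> S2" unfolding Q by blast
    show "- a \<notin> Q" if "a \<in> Q" for a
      using that cos_sin(1) unfolding Q_eq by auto
    show "sph_arc a b \<subseteq> Q" if ab: "a \<in> Q" "b \<in> Q" for a b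
    proof
      fix x assume "x \<in> sph_arc a b"
      then obtain s t where x: "norm x = 1" "0 \<le> s" "0 \<le> t" "x = s *\<^sub>R a + t *\<^sub>R b"
        by (auto simp: sph_arc_def)
      have "norm x \<le> s + t"
        using norm_triangle_ineq[of "s *\<^sub>R a" "t *\<^sub>R b"] x ab by (simp add: Q_eq)
      then have "cos \<rho> * 1 \<le> cos \<rho> * (s + t)" using x(1) cos_sin(1) by (intro mult_left_mono) auto
      also have "\<dots> = s * cos \<rho> + t * cos \<rho>" by (simp add: algebra_simps)
      also have "\<dots> \<le> s * (a \<bullet> p) + t * (b \<bullet> p)"
        using x ab by (intro add_mono mult_left_mono) (auto simp: Q_eq)
      finally show "x \<in> Q" using x ab by (simp add: Q_eq inner_add_left)
    qed
  qed
  moreover have "sph_interior Q \<noteq> {}"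
  proof -
    let ?O = "{x. cos \<rho> < x \<bullet> p} \<inter> {x. 0 < x \<bullet> u} \<inter> {x. 0 < x \<bullet> v}"
    define c a where "c = cos (\<rho> / 2)" and "a = sin (\<rho> / 2) / sqrt 2"
    have a: "0 < a" using radius by (simp add: a_def sin_gt_zero)
    have c: "cos \<rho> < c" unfolding c_def using radius by (intro cos_monotone_0_pi) auto
    let ?x = "c *\<^sub>R p + a *\<^sub>R u + a *\<^sub>R v"
    have co: "?x \<bullet> p = c" "?x \<bullet> u = a" "?x \<bullet> v = a"
      using selfs orth by (simp_all add: inner_add_left inner_commute[of u p] inner_commute[of v p] inner_commute[of v u])
    have "a\<^sup>2 = (sin (\<rho> / 2))\<^sup>2 / 2" by (simp add: a_def power_divide)
    then have "c\<^sup>2 + a\<^sup>2 + a\<^sup>2 = 1" using sin_cos_squared_add[of "\<rho> / 2"] unfolding c_def by linarith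
    from combination_in_Q[OF _ _ this] a c have "?x \<in> Q" by simp
    then have "?x \<in> S2 \<inter> ?O" using co a c unfolding Q_eq by simp
    moreover have "open ?O" by (intro open_Int open_Collect_less continuous_intros)
    then have "openin (top_of_set S2) (S2 \<inter> ?O)" by (rule openin_open_Int)
    moreover have "S2 \<inter> ?O \<subseteq> Q" unfolding Q_eq by auto
    ultimately have "?x \<in> sph_interior Q" unfolding sph_interior_def interior_of_def by blast
    then show ?thesis by blast
  qed
  ultimately show ?thesis by (simp add: sph_convex_body_def)
qed

text \<open>The bound is the condition at the point of the arc of \<open>Q\<close> in the direction opposite to the
  negative part of the \<open>(u, v)\<close> component of \<open>k\<close>. It says that this negative part is at most \<open>cot \<rho>\<close>
  times the \<open>p\<close> component.\<close>

lemma polar_Q_negative_part: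
  assumes k: "k \<in> polar Q"
  shows "0 \<le> k \<bullet> p"
    "sin \<rho> * sqrt ((min 0 (k \<bullet> u))\<^sup>2 + (min 0 (k \<bullet> v))\<^sup>2) \<le> cos \<rho> * (k \<bullet> p)"
proof -
  have "1 *\<^sub>R p + 0 *\<^sub>R u + 0 *\<^sub>R v \<in> Q" by (rule combination_in_Q) auto
  from polarD[OF k this] show kp: "0 \<le> k \<bullet> p" by simp
  define a b where "a = min 0 (k \<bullet> u)" and "b = min 0 (k \<bullet> v)"
  have ab: "a \<le> 0" "b \<le> 0" "a * (k \<bullet> u) = a\<^sup>2" "b * (k \<bullet> v) = b\<^sup>2"
    by (auto simp: a_def b_def min_def power2_eq_square)
  define r where "r = sqrt (a\<^sup>2 + b\<^sup>2)"
  have r2: "r\<^sup>2 = a\<^sup>2 + b\<^sup>2" by (simp add: r_def)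
  have "sin \<rho> * r \<le> cos \<rho> * (k \<bullet> p)"
  proof (cases "r = 0")
    case True
    then show ?thesis using kp cos_sin by simp
  next
    case False
    moreover have "0 \<le> r" by (simp add: r_def)
    ultimately have r: "0 < r" by simp
    have "cos \<rho> *\<^sub>R p + (sin \<rho> * (- a / r)) *\<^sub>R u + (sin \<rho> * (- b / r)) *\<^sub>R v \<in> Q"
    proof (rule combination_in_Q)
      have ab1: "(a / r)\<^sup>2 + (b / r)\<^sup>2 = 1"
        unfolding power_divide add_divide_distrib[symmetric] r2[symmetric] using r by simp
      have "(sin \<rho> * (- a / r))\<^sup>2 + (sin \<rho> * (- b / r))\<^sup>2
          = (sin \<rho>)\<^sup>2 * ((a / r)\<^sup>2 + (b / r)\<^sup>2)"
        by (simp only: power_mult_distrib distrib_left minus_divide_left[symmetric] power2_minus)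
      then have "(sin \<rho> * (- a / r))\<^sup>2 + (sin \<rho> * (- b / r))\<^sup>2 = (sin \<rho>)\<^sup>2"
        unfolding ab1 by simp
      then show "(cos \<rho>)\<^sup>2 + (sin \<rho> * (- a / r))\<^sup>2 + (sin \<rho> * (- b / r))\<^sup>2 = 1"
        using sin_cos_squared_add[of \<rho>] by linarith
    qed (use ab r cos_sin in \<open>auto simp: mult_le_0_iff divide_le_0_iff\<close>)
    from polarD[OF k this] have "0 \<le> cos \<rho> * (k \<bullet> p) - sin \<rho> * ((a * (k \<bullet> u) + b * (k \<bullet> v)) / r)"
      by (simp add: inner_add_right add_divide_distrib algebra_simps)
    also have "(a * (k \<bullet> u) + b * (k \<bullet> v)) / r = r"
      unfolding ab(3,4) r2[symmetric] using r by (simp add: power2_eq_square)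
    finally show ?thesis by simp
  qed
  then show "sin \<rho> * sqrt ((min 0 (k \<bullet> u))\<^sup>2 + (min 0 (k \<bullet> v))\<^sup>2) \<le> cos \<rho> * (k \<bullet> p)"
    by (simp add: r_def a_def b_def)
qed

text \<open>Write \<open>pos\<close> and \<open>neg\<close> for the norms of the positive and negative parts of the \<open>(u, v)\<close>
  component. Only products of opposite signs can be negative, so \<open>- (k \<bullet> l)\<close> is at most
  \<open>pos k * neg l + neg k * pos l\<close>. With \<open>A\<close> the norm of what is left of a vector after its positive
  part is removed, the previous lemma gives \<open>neg \<le> cos \<rho> * A\<close>, and \<open>pos k * A l + A k * pos l \<le> 1\<close>
  by the Cauchy-Schwarz inequality.\<close>

lemma polar_Q_inner:
  assumes k: "k \<in> polar Q" and l: "l \<in> polar Q"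
  shows "- cos \<rho> \<le> k \<bullet> l"
proof -
  define C S where "C = cos \<rho>" and "S = sin \<rho>"
  have CS: "0 < C" "0 < S" "C * C + S * S = 1" using cos_sin by (simp_all add: C_def S_def)
  define neg where "neg m = sqrt ((min 0 (m \<bullet> u))\<^sup>2 + (min 0 (m \<bullet> v))\<^sup>2)" for m
  define pos where "pos m = sqrt ((max 0 (m \<bullet> u))\<^sup>2 + (max 0 (m \<bullet> v))\<^sup>2)" for m
  define A where "A m = sqrt ((m \<bullet> p)\<^sup>2 + (neg m)\<^sup>2)" for m
  have m0: "0 \<le> neg m" "0 \<le> pos m" "0 \<le> A m" for m by (simp_all add: neg_def pos_def A_def)
  have split: "(min 0 x)\<^sup>2 + (max 0 x)\<^sup>2 = x\<^sup>2" for x :: real by (simp add: min_def max_def)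
  have sum: "(A m)\<^sup>2 + (pos m)\<^sup>2 = 1" and negA: "neg m \<le> C * A m" if m: "m \<in> polar Q" for m
  proof -
    have "1 = (m \<bullet> p)\<^sup>2 + (m \<bullet> u)\<^sup>2 + (m \<bullet> v)\<^sup>2"
      using expansion[of m m] inner_unit_self[OF polar_norm[OF m]] by (simp add: power2_eq_square)
    moreover have "(A m)\<^sup>2 + (pos m)\<^sup>2 = (m \<bullet> p)\<^sup>2 + ((min 0 (m \<bullet> u))\<^sup>2 + (min 0 (m \<bullet> v))\<^sup>2)
        + ((max 0 (m \<bullet> u))\<^sup>2 + (max 0 (m \<bullet> v))\<^sup>2)"
      by (simp add: A_def neg_def pos_def)
    ultimately show "(A m)\<^sup>2 + (pos m)\<^sup>2 = 1" using split[of "m \<bullet> u"] split[of "m \<bullet> v"] by linarith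
    have "S * neg m \<le> C * (m \<bullet> p)"
      using polar_Q_negative_part(2)[OF m] by (simp add: neg_def C_def S_def)
    then have "(S * neg m)\<^sup>2 \<le> (C * (m \<bullet> p))\<^sup>2" using CS m0 by (intro power_mono) auto
    moreover have "(neg m)\<^sup>2 = (C * C + S * S) * (neg m)\<^sup>2" using CS by simp
    ultimately have "(neg m)\<^sup>2 \<le> C\<^sup>2 * ((m \<bullet> p)\<^sup>2 + (neg m)\<^sup>2)"
      by (simp add: power_mult_distrib algebra_simps power2_eq_square)
    also have "\<dots> = (C * A m)\<^sup>2" by (simp add: A_def power_mult_distrib)
    finally show "neg m \<le> C * A m" by (rule power2_le_imp_le) (use CS m0 in simp)
  qed
  have prod: "- (max 0 x * - min 0 y) - (- min 0 x * max 0 y) \<le> x * y" for x y :: real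
    by (auto simp: min_def max_def zero_le_mult_iff mult_le_0_iff)
  have "k \<bullet> l = (k \<bullet> p) * (l \<bullet> p) + (k \<bullet> u) * (l \<bullet> u) + (k \<bullet> v) * (l \<bullet> v)" by (rule expansion)
  moreover have "0 \<le> (k \<bullet> p) * (l \<bullet> p)"
    using polar_Q_negative_part(1)[OF k] polar_Q_negative_part(1)[OF l] by simp
  moreover have "max 0 (k \<bullet> u) * - min 0 (l \<bullet> u) + max 0 (k \<bullet> v) * - min 0 (l \<bullet> v) \<le> pos k * neg l"
    using cauchy_schwarz_plane[of "max 0 (k \<bullet> u)" "- min 0 (l \<bullet> u)" "max 0 (k \<bullet> v)" "- min 0 (l \<bullet> v)"]
    by (simp add: pos_def neg_def)
  moreover have "- min 0 (k \<bullet> u) * max 0 (l \<bullet> u) + - min 0 (k \<bullet> v) * max 0 (l \<bullet> v) \<le> neg k * pos l"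
    using cauchy_schwarz_plane[of "- min 0 (k \<bullet> u)" "max 0 (l \<bullet> u)" "- min 0 (k \<bullet> v)" "max 0 (l \<bullet> v)"]
    by (simp add: pos_def neg_def)
  moreover have "pos k * neg l \<le> pos k * (C * A l)" "neg k * pos l \<le> (C * A k) * pos l"
    using negA[OF l] negA[OF k] m0 by (auto intro: mult_left_mono mult_right_mono)
  moreover have "pos k * (C * A l) + (C * A k) * pos l = C * (pos k * A l + A k * pos l)"
    by (simp add: algebra_simps)
  moreover have "C * (pos k * A l + A k * pos l) \<le> C * 1"
  proof (rule mult_left_mono)
    have "pos k * A l + A k * pos l \<le> sqrt ((pos k)\<^sup>2 + (A k)\<^sup>2) * sqrt ((A l)\<^sup>2 + (pos l)\<^sup>2)"
      by (rule cauchy_schwarz_plane)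
    then show "pos k * A l + A k * pos l \<le> 1" using sum[OF k] sum[OF l] by (simp add: add.commute)
  qed (use CS in simp)
  ultimately have "- C \<le> k \<bullet> l" using prod[of "k \<bullet> u" "l \<bullet> u"] prod[of "k \<bullet> v" "l \<bullet> v"] by linarith
  then show ?thesis by (simp add: C_def)
qed

lemma thickness_Q_ge: "\<rho> \<le> thickness Q"
proof -
  interpret body Q by unfold_locales (rule convex_body_Q)
  obtain k l where "k \<in> polar Q" "l \<in> polar Q" "k \<bullet> l = - cos (thickness Q)"
    using polar_inner_attained by blast
  then have "cos (thickness Q) \<le> cos \<rho>" using polar_Q_inner[of k l] by simp
  then show ?thesis using radius thickness_bounds cos_mono_le_eq[of "thickness Q" \<rho>] by simp
qed

end

context reduced_body
begin

text \<open>It suffices that every \<open>d\<close> in the polar is non-negative at \<open>x\<close>. If one of the \<open>u\<close> and \<open>v\<close>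
  components of \<open>d\<close> is non-negative, this follows from \<open>d\<close> being non-negative at \<open>p\<close> and at the ends
  of the arc. If both are negative, \<open>d\<close> is compared with the point of the arc \<open>uv\<close> of the polar
  opposite to its \<open>(u, v)\<close> component: their distance is at most \<open>\<pi> - \<Delta>\<close>, so that component has norm
  at most \<open>cos \<Delta>\<close> and the \<open>p\<close> component is at least \<open>sin \<Delta>\<close>.\<close>

lemma quarter_subset:
  assumes thin: "thickness R < pi / 2" and p: "p \<in> R" and uv: "u \<in> polar R" "v \<in> polar R"
    and orth: "p \<bullet> u = 0" "p \<bullet> v = 0" "u \<bullet> v = 0"
    and ends: "cos (thickness R) *\<^sub>R p + sin (thickness R) *\<^sub>R u \<in> R"
      "cos (thickness R) *\<^sub>R p + sin (thickness R) *\<^sub>R v \<in> R"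
    and x: "norm x = 1" "cos (thickness R) \<le> x \<bullet> p" "0 \<le> x \<bullet> u" "0 \<le> x \<bullet> v"
  shows "x \<in> R"
proof (rule bipolar[OF conv cpt x(1)])
  fix d assume d: "d \<in> polar R"
  define C S where "C = cos (thickness R)" and "S = sin (thickness R)"
  have S0: "0 < S" using sin_thickness by (simp add: S_def)
  have CS: "C\<^sup>2 + S\<^sup>2 = 1" by (simp add: C_def S_def)
  have C0: "0 < C" unfolding C_def using thin thickness_bounds by (intro cos_gt_zero) auto
  note n = norm_1[OF p] polar_norm[OF uv(1)] polar_norm[OF uv(2)]
  note ex = orthonormal_inner[OF n orth]
  define a b c where "a = d \<bullet> p" and "b = d \<bullet> u" and "c = d \<bullet> v"
  define x0 x1 x2 where "x0 = x \<bullet> p" and "x1 = x \<bullet> u" and "x2 = x \<bullet> v"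
  have dx: "d \<bullet> x = a * x0 + b * x1 + c * x2"
    using ex[of d x] by (simp add: a_def b_def c_def x0_def x1_def x2_def)
  have dd: "a\<^sup>2 + b\<^sup>2 + c\<^sup>2 = 1"
    using ex[of d d] inner_unit_self[OF polar_norm[OF d]] by (simp add: a_def b_def c_def power2_eq_square)
  have xx: "x0\<^sup>2 + x1\<^sup>2 + x2\<^sup>2 = 1"
    using ex[of x x] inner_unit_self[OF x(1)] by (simp add: x0_def x1_def x2_def power2_eq_square)
  have x': "C \<le> x0" "0 \<le> x1" "0 \<le> x2" using x by (simp_all add: C_def x0_def x1_def x2_def)
  have a0: "0 \<le> a" using polarD[OF d p] by (simp add: a_def)
  have db: "0 \<le> C * a + S * b" "0 \<le> C * a + S * c"
    using polarD[OF d ends(1)] polarD[OF d ends(2)] by (simp_all add: a_def b_def c_def C_def S_def inner_add_right)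
  have "C\<^sup>2 \<le> x0\<^sup>2" using x' C0 by (intro power_mono) auto
  then have x12: "x1\<^sup>2 + x2\<^sup>2 \<le> S\<^sup>2" using xx CS by linarith
  then have "x1\<^sup>2 \<le> S\<^sup>2" "x2\<^sup>2 \<le> S\<^sup>2" by (smt (verit) zero_le_power2)+
  then have xS: "x1 \<le> S" "x2 \<le> S" using S0 by (auto intro: power2_le_imp_le)
  have ax: "C * a \<le> a * x0" using mult_left_mono[OF x'(1) a0] by (simp add: mult.commute)
  have one: "0 \<le> C * a + y * z" if "0 \<le> C * a + S * y" "0 \<le> z" "z \<le> S" for y z
  proof (cases "0 \<le> y")
    case True
    then show ?thesis using C0 a0 that by simp
  next
    case False
    then have "y * S \<le> y * z" using that by (intro mult_left_mono_neg) auto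
    then show ?thesis using that by (simp add: mult.commute)
  qed
  show "0 \<le> d \<bullet> x"
  proof (cases "0 \<le> b \<or> 0 \<le> c")
    case True
    then have "0 \<le> b * x1 \<or> 0 \<le> c * x2" using x' by auto
    then show ?thesis unfolding dx using one[OF db(1) x'(2) xS(1)] one[OF db(2) x'(3) xS(2)] ax by linarith
  next
    case False
    then have bc: "b < 0" "c < 0" by auto
    define r where "r = sqrt (b\<^sup>2 + c\<^sup>2)"
    have r2: "r\<^sup>2 = b\<^sup>2 + c\<^sup>2" by (simp add: r_def)
    have r0: "0 < r" using bc by (simp add: r_def add_pos_pos)
    let ?m = "(- b) *\<^sub>R u + (- c) *\<^sub>R v"
    have m: "?m \<noteq> 0" "sgn ?m \<in> polar R"
      using conic_combination[OF sph_convex_polar uv, of "- b" "- c"] bc by auto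
    have "(norm ?m)\<^sup>2 = r\<^sup>2"
      using combination_norm[OF n(2,3), of "- b" "- c"] orth r2 by simp
    then have nm: "norm ?m = r" using r0 by (simp add: power2_eq_iff_nonneg)
    have "d \<bullet> ?m = - (r\<^sup>2)" unfolding r2 by (simp add: inner_add_right inner_diff_right power2_eq_square flip: b_def c_def)
    then have "d \<bullet> sgn ?m = - r" unfolding inner_sgn(2) nm using r0 by (simp add: power2_eq_square)
    with polar_inner_ge[OF d m(2)] have rC: "r \<le> C" by (simp add: C_def)
    then have "r\<^sup>2 \<le> C\<^sup>2" using r0 by (intro power_mono) auto
    then have "S\<^sup>2 \<le> a\<^sup>2" using dd r2 CS by linarith
    then have aS: "S \<le> a" using a0 by (rule power2_le_imp_le)
    have "(- b) * x1 + (- c) * x2 \<le> sqrt ((- b)\<^sup>2 + (- c)\<^sup>2) * sqrt (x1\<^sup>2 + x2\<^sup>2)"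
      by (rule cauchy_schwarz_plane)
    also have "\<dots> \<le> C * S"
    proof (rule mult_mono)
      show "sqrt ((- b)\<^sup>2 + (- c)\<^sup>2) \<le> C" using rC by (simp add: r_def)
      show "sqrt (x1\<^sup>2 + x2\<^sup>2) \<le> S" using x12 S0 by (intro real_le_lsqrt) auto
    qed (use C0 in auto)
    finally have "- (b * x1 + c * x2) \<le> C * S" by simp
    moreover have "C * S \<le> C * a" using aS C0 by simp
    ultimately show ?thesis unfolding dx using ax by linarith
  qed
qed

lemma disk_quarter_if_attained:
  assumes thin: "thickness R < pi / 2" and xy: "x \<in> R" "y \<in> R" "x \<bullet> y = (cos (thickness R))\<^sup>2"
  shows "is_disk_quarter R (thickness R)"
proof -
  have xy': "x \<in> thin_points" "y \<in> thin_points" using inner_ge_thin(2)[OF thin xy] by auto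
  obtain p u v where p: "p \<in> R" "u \<in> polar R" "v \<in> polar R"
    and orth: "p \<bullet> u = 0" "p \<bullet> v = 0" "u \<bullet> v = 0"
    and x: "x = cos (thickness R) *\<^sub>R p + sin (thickness R) *\<^sub>R u"
    and y: "y = cos (thickness R) *\<^sub>R p + sin (thickness R) *\<^sub>R v"
    using thin_points_inner(2)[OF thin xy' xy(3)] by blast
  note n = norm_1[OF p(1)] polar_norm[OF p(2)] polar_norm[OF p(3)]
  interpret quarter p u v "thickness R"
    by unfold_locales (use n orth thin thickness_bounds in auto)
  have "Q \<subseteq> R"
  proof
    fix z assume "z \<in> Q"
    then have "norm z = 1" "cos (thickness R) \<le> z \<bullet> p" "0 \<le> z \<bullet> u" "0 \<le> z \<bullet> v" by (auto simp: Q_eq)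
    then show "z \<in> R"
      by (rule quarter_subset[OF thin p orth xy(1,2)[unfolded x y]])
  qed
  with reduced convex_body_Q thickness_Q_ge have "Q = R"
    unfolding sph_reduced_def by (meson linorder_not_less)
  with n orth show ?thesis
    unfolding is_disk_quarter_def Q_def orthogonal_def
    by (intro bexI[of _ p] bexI[of _ u] bexI[of _ v] conjI) simp_all
qed

lemma attained_if_disk_quarter:
  assumes thin: "thickness R < pi / 2" and q: "is_disk_quarter R (thickness R)"
  shows "\<exists>x\<in>R. \<exists>y\<in>R. x \<bullet> y = (cos (thickness R))\<^sup>2"
proof -
  obtain p u v where p: "norm p = 1" "norm u = 1" "norm v = 1" "p \<bullet> u = 0" "p \<bullet> v = 0" "u \<bullet> v = 0"
    and R: "R = disk p (thickness R) \<inter> hemisphere u \<inter> hemisphere v"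
    using q unfolding is_disk_quarter_def orthogonal_def by auto
  interpret quarter p u v "thickness R"
    by unfold_locales (use p thin thickness_bounds in auto)
  have RQ: "R = Q" unfolding Q_def by (rule R)
  let ?x = "cos (thickness R) *\<^sub>R p + sin (thickness R) *\<^sub>R u + 0 *\<^sub>R v"
  let ?y = "cos (thickness R) *\<^sub>R p + 0 *\<^sub>R u + sin (thickness R) *\<^sub>R v"
  have "?x \<in> Q" "?y \<in> Q" by (rule combination_in_Q; use sin_thickness in simp)+
  then have "?x \<in> R" "?y \<in> R" using RQ by auto
  moreover have "?x \<bullet> ?y = (cos (thickness R))\<^sup>2"
    using selfs orth by (simp add: inner_add_left inner_add_right inner_commute[of u p] power2_eq_square)
  ultimately show ?thesis by blast
qed

end

theorem theorem4p2:
  fixes R :: "(real^3) set"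
  assumes "sph_reduced R"
  shows "(thickness R < pi / 2 \<longrightarrow>
            sph_diam R \<le> arccos ((cos (thickness R))\<^sup>2) \<and>
            (sph_diam R = arccos ((cos (thickness R))\<^sup>2) \<longleftrightarrow> is_disk_quarter R (thickness R))) \<and>
         (thickness R \<ge> pi / 2 \<longrightarrow> sph_diam R = thickness R)"
proof -
  interpret reduced_body R
    by unfold_locales (use assms in \<open>auto simp: sph_reduced_def\<close>)
  have "sph_diam R \<le> arccos ((cos (thickness R))\<^sup>2) \<and>
      (sph_diam R = arccos ((cos (thickness R))\<^sup>2) \<longleftrightarrow> is_disk_quarter R (thickness R))"
    if thin: "thickness R < pi / 2"
  proof -
    obtain a b where ab: "a \<in> R" "b \<in> R" and diam: "sph_diam R = arccos (a \<bullet> b)"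
      and min: "\<forall>x\<in>R. \<forall>y\<in>R. a \<bullet> b \<le> x \<bullet> y"
      using sph_diam_attained by blast
    let ?c = "(cos (thickness R))\<^sup>2"
    have c: "- 1 \<le> ?c" "?c \<le> 1" by (simp_all add: abs_square_le_1 order_trans[OF _ zero_le_power2])
    have i: "- 1 \<le> a \<bullet> b" "a \<bullet> b \<le> 1" by (rule inner_unit_bounds; use ab norm_1 in simp)+
    have ge: "?c \<le> a \<bullet> b" by (rule inner_ge_thin(1)[OF thin ab])
    then have "sph_diam R \<le> arccos ?c"
      unfolding diam using c i by (intro arccos_le_arccos) auto
    moreover have "sph_diam R = arccos ?c \<longleftrightarrow> a \<bullet> b = ?c"
      unfolding diam using c i by (subst arccos_eq_iff) (auto simp: abs_le_iff)
    moreover have "a \<bullet> b = ?c \<longleftrightarrow> is_disk_quarter R (thickness R)"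
    proof
      assume "a \<bullet> b = ?c"
      then show "is_disk_quarter R (thickness R)" by (rule disk_quarter_if_attained[OF thin ab])
    next
      assume "is_disk_quarter R (thickness R)"
      then obtain x y where "x \<in> R" "y \<in> R" "x \<bullet> y = ?c"
        using attained_if_disk_quarter[OF thin] by blast
      with min have "a \<bullet> b \<le> ?c" by metis
      with ge show "a \<bullet> b = ?c" by simp
    qed
    ultimately show ?thesis by blast
  qed
  with sph_diam_wide show ?thesis by blast
qed

end
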